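(* Let $n$ be prime and let $0 \neq a,b \in \mathbb{F}_n$. Then $$\Sigma_{a,b} = \left| \sum_{k=1}^{n} \operatorname{sign} \left( \cos \left( \frac{2\pi}{n} a k \right) \right) \operatorname{sign} \left( \cos \left( \frac{2\pi}{n} b k \right) \right) \right|$$ satisfies the following estimates. (1) There is a nearly exact formula when $\|a^{-1}b\|$ is small: $$\Sigma_{a,b} = \frac{n}{\|a^{-1}b\|}\, 1_{\left[\|a^{-1}b\| \text{ is odd}\right]} + \mathcal{O}(\|a^{-1}b\|).$$ (2) For any $1 \leq m < n$ we have $$\Sigma_{a,b} \leq \left( \frac{2}{m+2} + \sum_{\ell=1}^{m} \frac{12}{\ell\, \| \ell a^{-1}b\|} \right) n + \mathcal{O}(1).$$ (3) More generally, we have, for a suitable measure $\mu$, $$\Sigma_{a,b} = \left| \frac{4n}{\pi} \sum_{\substack{\ell = 1 \\ \ell \text{ odd}}}^{\infty} \frac{(-1)^{(\ell-1)/2}}{\ell} \cdot \Re\, \widehat{\mu}(\ell) \right| + \mathcal{O}(1).$$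
   Context: Here $\operatorname{sign}(x)=+1$ if $x\ge 0$ and $-1$ otherwise (the choice of value for $\operatorname{sign}(0)$ does not matter). $\mathbb{F}_n$ is the field with $n$ elements, identified with $\{0,1,\dots,n-1\}$; both $a$ and $b$ are nonzero, and $a^{-1}b$ and $\ell a^{-1}b$ are computed in $\mathbb{F}_n$. For $x\in\mathbb{F}_n$, $\|x\|=\min\{x,n-x\}$ measures the toroidal distance from $0$. The symbol $1_{[\cdot]}$ is the indicator of a condition, and $m$ and $\ell$ denote integers. In (3), $\mu$ is a measure on $\mathbb{T}=\mathbb{R}/\mathbb{Z}$ (which may depend on $n,a,b$), with Fourier coefficients $\widehat{\mu}(\ell)=\int_{\mathbb{T}} e^{-2\pi i \ell x}\,d\mu(x)$, and $\Re$ denotes the real part; the series in (3) does not converge absolutely. The constants implied by $\mathcal{O}$ are absolute. *)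

theory Defs
  imports "HOL-Analysis.Analysis" "HOL-Number_Theory.Residues"
begin

definition sign_pm :: "real \<Rightarrow> real" where
  "sign_pm x = (if x \<ge> 0 then 1 else -1)"

definition sign_cos_sum :: "nat \<Rightarrow> int \<Rightarrow> int \<Rightarrow> real" where
  "sign_cos_sum n a b =
     \<bar>\<Sum>k = 1..n. sign_pm (cos (2 * pi / real n * of_int a * real k)) *
                  sign_pm (cos (2 * pi / real n * of_int b * real k))\<bar>"

text \<open>Intended for elements of \<^term>\<open>carrier (residue_ring (int n))\<close>, that is
  \<open>0 \<le> x < n\<close>.\<close>

definition toroidal_norm :: "nat \<Rightarrow> int \<Rightarrow> int" where
  "toroidal_norm n x = min x (int n - x)"

definition field_quot :: "nat \<Rightarrow> int \<Rightarrow> int \<Rightarrow> int" where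
  "field_quot n a b =
     inv\<^bsub>residue_ring (int n)\<^esub> a \<otimes>\<^bsub>residue_ring (int n)\<^esub> b"

text \<open>The circle \<open>\<real>/\<int>\<close> with the quotient topology; its Borel \<open>\<sigma>\<close>-algebra is
  the library's \<^const>\<open>borel\<close> at this type.\<close>

quotient_type torus = real / "\<lambda>x y :: real. x - y \<in> \<int>"
proof (rule equivpI)
  show "reflp (\<lambda>x y :: real. x - y \<in> \<int>)"
    by (simp add: reflp_def)
  show "symp (\<lambda>x y :: real. x - y \<in> \<int>)"
    proof (rule sympI)
    fix x y :: real
    assume "x - y \<in> \<int>"
    then have "- (x - y) \<in> \<int>" by (rule Ints_minus)
    then show "y - x \<in> \<int>" by simp
  qed
  show "transp (\<lambda>x y :: real. x - y \<in> \<int>)"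
  proof (rule transpI)
    fix x y z :: real
    assume "x - y \<in> \<int>" "y - z \<in> \<int>"
    then have "(x - y) + (y - z) \<in> \<int>" by (rule Ints_add)
    then show "x - z \<in> \<int>" by simp
  qed
qed

instantiation torus :: topological_space
begin

definition open_torus :: "torus set \<Rightarrow> bool" where
  "open_torus U \<longleftrightarrow> open (abs_torus -` U)"

instance
proof
  show "open (UNIV :: torus set)"
    by (simp add: open_torus_def)
next
  fix S T :: "torus set"
  assume "open S" "open T"
  then show "open (S \<inter> T)"
    by (simp add: open_torus_def open_Int)
next
  fix K :: "torus set set"
  assume "\<forall>S\<in>K. open S"
  then show "open (\<Union>K)"
    by (auto simp: open_torus_def vimage_Union)
qed

end

lift_definition torus_char :: "int \<Rightarrow> torus \<Rightarrow> complex" is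
  "\<lambda>l x. exp (- 2 * of_real pi * \<i> * of_int l * of_real x)"
proof -
  fix l :: int and x y :: real
  assume "x - y \<in> \<int>"
  then obtain k where "x - y = of_int k"
    by (rule Ints_cases)
  then have k: "x = y + of_int k"
    by simp
  have "- 2 * of_real pi * \<i> * of_int l * of_real x =
      - 2 * of_real pi * \<i> * of_int l * of_real y + of_int (2 * (- l * k)) * pi * \<i>"
    by (simp add: k algebra_simps)
  then show "exp (- 2 * of_real pi * \<i> * of_int l * of_real x) =
      exp (- 2 * of_real pi * \<i> * of_int l * of_real y)"
    unfolding exp_eq by (intro exI[of _ "- l * k"]) simp
qed

text \<open>For a finite Borel measure the integral below is a genuine one, because
  the integrand is continuous and has modulus one.\<close>

definition fourier_coeff :: "torus measure \<Rightarrow> int \<Rightarrow> complex" where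
  "fourier_coeff M l = (\<integral>x. torus_char l x \<partial>M)"

lemma continuous_on_torus_char: "continuous_on UNIV (torus_char l)"
proof -
  have "open (torus_char l -` B)" if "open B" for B
  proof -
    have "abs_torus -` torus_char l -` B =
        (\<lambda>x. exp (- 2 * of_real pi * \<i> * of_int l * of_real x)) -` B"
      by (auto simp: torus_char.abs_eq)
    moreover have "open ((\<lambda>x::real. exp (- 2 * of_real pi * \<i> * of_int l * of_real x)) -` B)"
      by (intro open_vimage that continuous_intros)
    ultimately show ?thesis
      by (simp add: open_torus_def)
  qed
  then show ?thesis
    by (simp add: continuous_on_open_vimage)
qed

lemma norm_torus_char: "norm (torus_char l t) = 1"
  by transfer (simp add: norm_exp_eq_Re)

lemma integrable_torus_char:
  assumes "finite_measure M" "sets M = sets borel"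
  shows "integrable M (torus_char l)"
proof -
  interpret finite_measure M by fact
  have "torus_char l \<in> borel_measurable M"
    using borel_measurable_continuous_onI[OF continuous_on_torus_char]
      measurable_cong_sets[OF assms(2) refl] by blast
  then show ?thesis
    by (intro integrable_const_bound[where B = 1]) (simp_all add: norm_torus_char)
qed

end

(*
The substitution k -> a^-1 k turns the sum into corr c 0 = sum_k f(k) f(c k), where
f(k) = sign (cos (2 pi k / n)) and c = a^-1 b. For c = d small, f(d k) is constant along long runs,
and the sum is compared with increments of the triangle wave, the primitive of the square wave.

For the bound by harmonics, replace f(c k) by its average over the translates f(c k - t) with weights
given by a Jackson-type kernel: the square of a trigonometric polynomial with coefficients q - |i|.
The average is a trigonometric polynomial in c k, and its correlation with f is controlled by the
Fourier coefficients F(l) F(l c). The error of the replacement is n - sum_k f(k) f(k - t) averaged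
over t, which is again explicit in the F(l)^2. The constant 2/(m+2) comes out because
sum_{l odd} 1/l^2 = pi^2/8, and because an even harmonic of f has size O(1), so that
the kernel may have degree m + 1 when m is odd.
*)
theory Submission
  imports Defs
begin

section \<open>Numerical estimates\<close>

text \<open>The averaging step rests on positivity: the kernel is nonnegative, and the error at
  shift t is at most \<open>n - corr 1 t\<close>, in which c no longer occurs because multiplication
  by c permutes the residues. So the averaged error concerns f alone. It grows roughly linearly in
  t, and this rules out the plain Fejer kernel: its weights 1 - l/q lose 1/(q l) at each harmonic,
  in total n log q / q. Squaring that kernel gives weights 1 - O(l^2/q^2) and a loss O(n/q), whose
  constant has to be tracked precisely to end at n/q.

  The prime 2 is split off. For odd n the cosine never vanishes at 2 pi k / n, so over a period f is
  2 * 1_[-r, r] - 1 with sum 1 or -1. Hence \<open>corr c 0\<close> is, up to 1, twice the sum of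
  f(c k) over the window |k| <= r. Both the formula for small multipliers and the measure start from
  this window sum: the first reads it as a Riemann sum, the second expands each of its terms in the
  Fourier series of the square wave.\<close>

lemma odd_squares_sums: "(\<lambda>j::nat. 1 / (2 * real j + 1)\<^sup>2) sums (pi\<^sup>2 / 8)"
proof -
  have inv: "(\<lambda>n::nat. 1 / (real n + 1)\<^sup>2) sums (pi\<^sup>2 / 6)"
    using inverse_squares_sums by (simp add: add.commute)
  \<comment> \<open>Each pair consists of an odd square term and a quarter of a term of the full
    series; the latter is then subtracted.\<close>
  have "(\<lambda>n. \<Sum>i\<in>{n * 2..<n * 2 + 2}. 1 / (real i + 1)\<^sup>2) sums (pi\<^sup>2 / 6)"
    by (rule sums_group[OF inv]) simp
  moreover have "(\<Sum>i\<in>{n * 2..<n * 2 + 2}. 1 / (real i + 1)\<^sup>2)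
      = 1 / (2 * real n + 1)\<^sup>2 + (1/4) * (1 / (real n + 1)\<^sup>2)" for n :: nat
  proof -
    have "{n * 2..<n * 2 + 2} = {2 * n, 2 * n + 1}" by auto
    moreover have "(2 * real n + 2)\<^sup>2 = 4 * (real n + 1)\<^sup>2" by (simp add: power2_eq_square algebra_simps)
    ultimately show ?thesis by (simp add: add.commute)
  qed
  ultimately have "(\<lambda>n. 1 / (2 * real n + 1)\<^sup>2 + (1/4) * (1 / (real n + 1)\<^sup>2)) sums (pi\<^sup>2 / 6)"
    by simp
  from sums_diff[OF this sums_mult[OF inv, of "1/4"]]
  show ?thesis by simp
qed

text \<open>Since 1/(2p+1)^2 <= 1/(4p) - 1/(4(p+1)), the partial sum plus 1/(4p) decreases in p, and
  its limit is pi^2/8.\<close>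

lemma odd_squares_partial_sum_ge:
  assumes "p \<ge> 1"
  shows "(\<Sum>j<p. 1 / (2 * real j + 1)\<^sup>2) \<ge> pi\<^sup>2 / 8 - 1 / (4 * real p)"
proof -
  define u where "u p = (\<Sum>j<Suc p. 1 / (2 * real j + 1)\<^sup>2) + 1 / (4 * real (Suc p))" for p
  have "u (Suc p) \<le> u p" for p
  proof -
    have "1 / (2 * real (Suc p) + 1)\<^sup>2 \<le> 1 / (4 * real (Suc p) * real (Suc (Suc p)))"
      by (intro divide_left_mono mult_pos_pos zero_less_power)
        (auto simp: power2_eq_square algebra_simps)
    also have "\<dots> = 1 / (4 * real (Suc p)) - 1 / (4 * real (Suc (Suc p)))"
      by (simp add: divide_simps)
    finally show ?thesis by (simp add: u_def)
  qed
  then have "decseq u" by (rule decseq_SucI)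
  moreover have "u \<longlonglongrightarrow> pi\<^sup>2 / 8 + 0"
    unfolding u_def
  proof (intro tendsto_add)
    show "(\<lambda>p. \<Sum>j<Suc p. 1 / (2 * real j + 1)\<^sup>2) \<longlonglongrightarrow> pi\<^sup>2 / 8"
      using odd_squares_sums unfolding sums_def by (rule LIMSEQ_Suc)
    have "(\<lambda>p. (1/4) * inverse (real (Suc p))) \<longlonglongrightarrow> (1/4) * 0"
      by (intro tendsto_intros LIMSEQ_inverse_real_of_nat)
    then show "(\<lambda>p. 1 / (4 * real (Suc p))) \<longlonglongrightarrow> 0"
      by (simp add: field_simps)
  qed
  ultimately have "u (p - 1) \<ge> pi\<^sup>2 / 8" using decseq_ge by fastforce
  then show ?thesis using assms by (simp add: u_def)
qed

text \<open>This is the slack that turns a total loss of \<open>(6/5) / real q\<close> in the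
  weighted sum below into \<open>1 / real q\<close>. Eight terms are the fewest whose sum reaches
  6/5.\<close>

lemma pi_squared_lower_bound: "pi\<^sup>2 / 8 \<ge> 6 / 5"
proof -
  have "(\<Sum>j<8. 1 / (2 * real j + 1)\<^sup>2) \<le> pi\<^sup>2 / 8"
    using sum_le_suminf[OF sums_summable[OF odd_squares_sums], of "{..<8}"]
      sums_unique[OF odd_squares_sums] by simp
  moreover have "(\<Sum>j<8. 1 / (2 * real j + 1)\<^sup>2) \<ge> 6 / 5"
    by (simp add: eval_nat_numeral power2_eq_square)
  ultimately show ?thesis by linarith
qed

text \<open>The Taylor bound sin x >= x - x^3/6 together with x < 2. Combined with pi >= 3 it gives
  sin (pi l / (2 n)) >= l / (2 n).\<close>

lemma sin_ge_third:
  assumes "0 \<le> x" "x \<le> pi / 2"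
  shows "sin x \<ge> x / 3"
proof -
  have "\<bar>sin x - (\<Sum>m<3. sin_coeff m * x ^ m)\<bar> \<le> inverse (fact 3) * \<bar>x\<bar> ^ 3"
    by (rule Maclaurin_sin_bound)
  then have "\<bar>sin x - x\<bar> \<le> x ^ 3 / 6"
    using assms by (simp add: eval_nat_numeral sin_coeff_def field_simps)
  moreover have "x * x \<le> 2 * 2" using assms pi_half_less_two by (intro mult_mono) linarith+
  then have "x * (x * x) \<le> x * 4" using assms by (intro mult_left_mono) auto
  then have "x ^ 3 / 6 \<le> x * 2 / 3" by (simp add: power3_eq_cube)
  ultimately show ?thesis by linarith
qed

lemma pi_ge_3: "pi \<ge> 3"
proof (rule power2_le_imp_le)
  show "3\<^sup>2 \<le> pi\<^sup>2" using pi_squared_lower_bound by simp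
qed simp

text \<open>The weights are the closed form of \<open>tent_conv q l / tent_conv q 0\<close> at \<open>l = 2 j + 1\<close>,
  see \<open>tent_conv_formula\<close> below.\<close>

lemma jackson_weighted_sum_ge:
  fixes q :: nat
  assumes "q \<ge> 2"
  defines "A0 \<equiv> real q * (2 * (real q)\<^sup>2 + 1) / 3"
  shows "1 - 8 / pi\<^sup>2 * (\<Sum>j<(q + 1) div 2.
     ((A0 - real q * (2 * real j + 1)\<^sup>2 + ((2 * real j + 1) ^ 3 - (2 * real j + 1)) / 2) / A0)
       / (2 * real j + 1)\<^sup>2) \<le> 1 / real q"
proof -
  define p where "p = (q + 1) div 2"
  have p: "p \<ge> 1" using assms(1) by (simp add: p_def)
  have A0: "A0 > 0" using assms(1) by (simp add: A0_def add_pos_nonneg)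
  have "(\<Sum>j<p. 1 / (2 * real j + 1)\<^sup>2 - (real q - (2 * real j + 1) / 2 + 1 / 2) / A0)
    \<le> (\<Sum>j<p. ((A0 - real q * (2 * real j + 1)\<^sup>2 + ((2 * real j + 1) ^ 3 - (2 * real j + 1)) / 2) / A0)
       / (2 * real j + 1)\<^sup>2)"
  proof (rule sum_mono)
    fix j
    define l where "l = 2 * real j + 1"
    have l: "l \<ge> 1" by (simp add: l_def)
    have "((A0 - real q * l\<^sup>2 + (l ^ 3 - l) / 2) / A0) / l\<^sup>2 = 1 / l\<^sup>2 - (real q - l / 2 + 1 / (2 * l)) / A0"
      using l A0 by (simp add: field_simps power2_eq_square power3_eq_cube)
    \<comment> \<open>Replacing 1/(2l) by its value at l = 1 makes the loss linear in l, so that it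
      sums in closed form.\<close>
    moreover have "1 / (2 * l) \<le> 1 / 2" using l by (simp add: field_simps)
    then have "(real q - l / 2 + 1 / (2 * l)) / A0 \<le> (real q - l / 2 + 1 / 2) / A0"
      using A0 by (intro divide_right_mono) auto
    ultimately show "1 / (2 * real j + 1)\<^sup>2 - (real q - (2 * real j + 1) / 2 + 1 / 2) / A0
      \<le> ((A0 - real q * (2 * real j + 1)\<^sup>2 + ((2 * real j + 1) ^ 3 - (2 * real j + 1)) / 2) / A0)
       / (2 * real j + 1)\<^sup>2" by (simp add: l_def)
  qed
  moreover have "(\<Sum>j<p. 1 / (2 * real j + 1)\<^sup>2 - (real q - (2 * real j + 1) / 2 + 1 / 2) / A0)
     = (\<Sum>j<p. 1 / (2 * real j + 1)\<^sup>2) - (real q * real p - (real p)\<^sup>2 / 2 + real p / 2) / A0"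
  proof -
    have "(\<Sum>j<p. real q - (2 * real j + 1) / 2 + 1 / 2) = real q * real p - (real p)\<^sup>2 / 2 + real p / 2"
      by (induction p) (simp_all add: field_simps power2_eq_square)
    then show ?thesis by (simp only: sum_subtractf sum_divide_distrib[symmetric])
  qed
  moreover have "(\<Sum>j<p. 1 / (2 * real j + 1)\<^sup>2) \<ge> pi\<^sup>2 / 8 - 1 / (4 * real p)"
    using p by (rule odd_squares_partial_sum_ge)
  \<comment> \<open>For large q the missing tail costs about 1/(2q) and the weights about 9/(16q).
    The margin is thinnest for small q: at q = 2 the claim is 7/12 <= 3/5.\<close>
  moreover have "1 / (4 * real p) + (real q * real p - (real p)\<^sup>2 / 2 + real p / 2) / A0 \<le> (6/5) / real q"
  proof (cases "even q")
    case True
    then have q: "q = 2 * p" by (auto simp: p_def)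
    have rp: "real p \<ge> 1" using p by simp
    have e1: "(real q * real p - (real p)\<^sup>2 / 2 + real p / 2) / A0 = (9 * real p + 3) / (4 * (8 * (real p)\<^sup>2 + 1))"
    proof -
      have "8 * (real p)\<^sup>2 + 1 > 0" by (simp add: add_nonneg_pos)
      then show ?thesis using rp unfolding A0_def q
        by (simp add: divide_simps) (simp add: power2_eq_square algebra_simps)
    qed
    have e2: "(9 * real p + 3) / (4 * (8 * (real p)\<^sup>2 + 1)) \<le> (7 / 20) / real p"
    proof -
      have "0 \<le> (real p - 1) * (11 * real p - 4) + 3" using rp by (intro add_nonneg_nonneg mult_nonneg_nonneg) auto
      then have "(9 * real p + 3) * real p * 5 \<le> 7 * (8 * (real p)\<^sup>2 + 1)"
        by (simp add: power2_eq_square algebra_simps)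
      moreover have "8 * (real p)\<^sup>2 + 1 > 0" by (simp add: add_nonneg_pos)
      ultimately show ?thesis using rp by (simp add: field_simps)
    qed
    have e3: "(6/5) / real q = 1 / (4 * real p) + (7 / 20) / real p" using rp q by (simp add: field_simps)
    show ?thesis unfolding e1 e3 by (rule add_left_mono) (rule e2)
  next
    case False
    then have q: "q + 1 = 2 * p" by (auto simp: p_def)
    \<comment> \<open>An odd q >= 2 is at least 3, so p >= 2; written in x = p - 2 the cleared
      inequality has only positive coefficients.\<close>
    define x where "x = real p - 2"
    have x: "x \<ge> 0" using q assms(1) by (simp add: x_def)
    have rq: "real q = 2 * x + 3" and rp: "real p = x + 2" using q by (auto simp: x_def)
    have "2 * (2 * x + 3)\<^sup>2 + 1 > 0" by (simp add: add_nonneg_pos)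
    then show ?thesis using x unfolding A0_def rq rp
      by (simp add: divide_simps) (simp add: power2_eq_square algebra_simps)
  qed
  ultimately have "(\<Sum>j<p. ((A0 - real q * (2 * real j + 1)\<^sup>2 + ((2 * real j + 1) ^ 3 - (2 * real j + 1)) / 2) / A0)
       / (2 * real j + 1)\<^sup>2) \<ge> pi\<^sup>2 / 8 - (6/5) / real q" (is "?L \<ge> _")
    by linarith
  moreover have "(6/5) / real q \<le> (pi\<^sup>2 / 8) / real q"
    by (intro divide_right_mono pi_squared_lower_bound) simp
  ultimately have "?L \<ge> pi\<^sup>2 / 8 - (pi\<^sup>2 / 8) / real q" by linarith
  then have "8 / pi\<^sup>2 * ?L \<ge> 8 / pi\<^sup>2 * (pi\<^sup>2 / 8 - (pi\<^sup>2 / 8) / real q)"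
    by (intro mult_left_mono) auto
  moreover have "8 / pi\<^sup>2 * (pi\<^sup>2 / 8 - (pi\<^sup>2 / 8) / real q) = 1 - 1 / real q"
    by (simp add: right_diff_distrib)
  ultimately show ?thesis unfolding p_def by linarith
qed

section \<open>Square wave and triangle wave\<close>

lemma cos_alternating_odd_sum:
  "2 * cos \<theta> * (\<Sum>j<N. (-1) ^ j * sin ((2 * real j + 1) * \<theta>)) = - ((-1) ^ N) * sin (2 * real N * \<theta>)"
proof (induction N)
  case (Suc N)
  have "2 * cos \<theta> * sin ((2 * real N + 1) * \<theta>) = sin (2 * real (Suc N) * \<theta>) + sin (2 * real N * \<theta>)"
    using sin_add[of "(2 * real N + 1) * \<theta>" \<theta>] sin_diff[of "(2 * real N + 1) * \<theta>" \<theta>]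
    by (simp add: algebra_simps)
  with Suc show ?case by (simp add: algebra_simps)
qed simp

text \<open>The partial sum has derivative (-1)^N sin (2 N t) / (2 cos t), which oscillates but does
  not decay. \<open>Q\<close> adds the boundary term of one integration by parts: this term tends to
  0 pointwise and leaves a derivative of size O(1/N) between -|\<theta>| and |\<theta>|. So the
  limit at \<theta> equals the limit at 0, which is the Leibniz series.\<close>

lemma square_wave_sums_central:
  assumes "\<bar>\<theta>\<bar> < pi / 2"
  shows "(\<lambda>j. (-1) ^ j / (2 * real j + 1) * cos ((2 * real j + 1) * \<theta>)) sums (pi / 4)"
proof -
  define P where "P N t = (\<Sum>j<N. (-1) ^ j / (2 * real j + 1) * cos ((2 * real j + 1) * t))" for N :: nat and t
  define Q where "Q N t = P N t + (-1) ^ N * cos (2 * real N * t) / (4 * real N * cos t)" for N :: nat and t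
  define B where "B = 1 / (4 * (cos \<theta>)\<^sup>2)"
  have cp: "cos t \<ge> cos \<theta> \<and> cos \<theta> > 0" if "\<bar>t\<bar> \<le> \<bar>\<theta>\<bar>" for t
  proof -
    have "cos \<bar>\<theta>\<bar> > 0" using assms by (intro cos_gt_zero_pi) auto
    moreover have "cos \<bar>\<theta>\<bar> \<le> cos \<bar>t\<bar>" using that assms by (intro cos_monotone_0_pi_le) auto
    ultimately show ?thesis by simp
  qed
  have P': "((\<lambda>t. P N t) has_real_derivative (- (\<Sum>j<N. (-1) ^ j * sin ((2 * real j + 1) * t)))) (at t)" for N t
    unfolding P_def
    by (auto intro!: derivative_eq_intros simp: sum_negf[symmetric] intro!: sum.cong)
  have Q': "((\<lambda>t. Q N t) has_real_derivative ((-1) ^ N * cos (2 * real N * t) * sin t / (4 * real N * (cos t)\<^sup>2))) (at t)"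
    if N: "N > 0" and t: "\<bar>t\<bar> \<le> \<bar>\<theta>\<bar>" for N t
  proof -
    have c: "cos t \<noteq> 0" using cp[OF t] by linarith
    have eq: "(\<Sum>j<N. (-1) ^ j * sin ((2 * real j + 1) * t)) = - ((-1) ^ N) * sin (2 * real N * t) / (2 * cos t)"
      using cos_alternating_odd_sum[of t N] c by (simp add: field_simps)
    show ?thesis unfolding Q_def
      using N c by (auto intro!: derivative_eq_intros P' simp: eq) (simp add: field_simps power2_eq_square)
  qed
  have bound: "\<bar>Q N \<theta> - Q N 0\<bar> \<le> (B * \<bar>\<theta>\<bar>) * (1 / real N)" if N: "N > 0" for N
  proof -
    have "norm (Q N \<theta> - Q N 0) \<le> (B / real N) * norm (\<theta> - 0)"
    proof (rule field_differentiable_bound[of "{-\<bar>\<theta>\<bar>..\<bar>\<theta>\<bar>}"])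
      fix t assume t: "t \<in> {-\<bar>\<theta>\<bar>..\<bar>\<theta>\<bar>}"
      then have t': "\<bar>t\<bar> \<le> \<bar>\<theta>\<bar>" by auto
      show "((\<lambda>t. Q N t) has_field_derivative ((-1) ^ N * cos (2 * real N * t) * sin t / (4 * real N * (cos t)\<^sup>2))) (at t within {-\<bar>\<theta>\<bar>..\<bar>\<theta>\<bar>})"
        using Q'[OF N t'] by (rule DERIV_subset) auto
      have "\<bar>cos (2 * real N * t)\<bar> * \<bar>sin t\<bar> \<le> 1 * 1" by (intro mult_mono) auto
      moreover have "(cos \<theta>)\<^sup>2 \<le> (cos t)\<^sup>2" using cp[OF t'] by (intro power_mono) auto
      moreover have "(cos \<theta>)\<^sup>2 > 0" using cp[OF t'] by simp
      ultimately have "\<bar>cos (2 * real N * t)\<bar> * \<bar>sin t\<bar> / (4 * real N * (cos t)\<^sup>2) \<le> 1 / (4 * real N * (cos \<theta>)\<^sup>2)"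
        using N by (intro frac_le) auto
      then show "norm ((-1) ^ N * cos (2 * real N * t) * sin t / (4 * real N * (cos t)\<^sup>2)) \<le> B / real N"
        by (simp add: B_def abs_mult power_abs mult_ac)
    qed auto
    then show ?thesis by simp
  qed
  have "(\<lambda>N. Q N \<theta> - Q N 0) \<longlonglongrightarrow> 0"
  proof (rule Lim_null_comparison)
    show "\<forall>\<^sub>F N in sequentially. norm (Q N \<theta> - Q N 0) \<le> (B * \<bar>\<theta>\<bar>) * (1 / real N)"
      using eventually_gt_at_top[of 0] by eventually_elim (use bound in auto)
    show "(\<lambda>N. (B * \<bar>\<theta>\<bar>) * (1 / real N)) \<longlonglongrightarrow> 0"
      by (rule tendsto_mult_right_zero) (rule lim_1_over_n)
  qed
  moreover have corr: "(\<lambda>N. (-1) ^ N * cos (2 * real N * t) / (4 * real N * cos t)) \<longlonglongrightarrow> 0" for t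
  proof (rule Lim_null_comparison)
    have "\<bar>(-1) ^ N * cos (2 * real N * t) / (4 * real N * cos t)\<bar> \<le> 1 / (4 * real N * \<bar>cos t\<bar>)" for N
      by (simp add: abs_mult power_abs divide_right_mono)
    then show "\<forall>\<^sub>F N in sequentially. norm ((-1) ^ N * cos (2 * real N * t) / (4 * real N * cos t)) \<le> 1 / (4 * \<bar>cos t\<bar>) * (1 / real N)"
      by (simp add: mult_ac)
    show "(\<lambda>N. 1 / (4 * \<bar>cos t\<bar>) * (1 / real N)) \<longlonglongrightarrow> 0"
      by (rule tendsto_mult_right_zero) (rule lim_1_over_n)
  qed
  moreover have "(\<lambda>N. P N 0) \<longlonglongrightarrow> pi / 4"
  proof -
    have "summable (\<lambda>k. (-1) ^ k * 1 / real (k * 2 + 1))"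
      using summable_arctan_series[of "1::real"] by simp
    then have "(\<lambda>k. (-1) ^ k * 1 / real (k * 2 + 1)) sums (pi / 4)"
      using pi_series by (simp add: sums_iff)
    then show ?thesis unfolding sums_def P_def by (simp add: mult.commute add.commute)
  qed
  ultimately have "(\<lambda>N. (Q N \<theta> - Q N 0) - (-1) ^ N * cos (2 * real N * \<theta>) / (4 * real N * cos \<theta>)
      + (-1) ^ N * cos (2 * real N * 0) / (4 * real N * cos 0) + P N 0) \<longlonglongrightarrow> 0 - 0 + 0 + pi / 4"
    by (intro tendsto_intros)
  then have "(\<lambda>N. P N \<theta>) \<longlonglongrightarrow> pi / 4" by (simp add: Q_def)
  then show ?thesis by (simp add: sums_def P_def)
qed

lemma cos_add_int_pi: "cos (x + of_int k * pi) = (if even k then cos x else - cos x)"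
proof (cases "even k")
  case True
  then obtain e where "k = 2 * e" by auto
  then have "of_int k * pi = 2 * pi * of_int e" by simp
  then show ?thesis using True by (simp only: cos_add) (simp add: sin_integer_2pi cos_integer_2pi)
next
  case False
  then obtain e where "k = 2 * e + 1" by (auto elim: oddE)
  then have "of_int k * pi = 2 * pi * of_int e + pi" by (simp add: algebra_simps)
  then show ?thesis using False
    by (simp only: cos_add sin_add) (simp add: sin_integer_2pi cos_integer_2pi)
qed

text \<open>The half-integer nearest to x is \<open>half_period x / 2\<close>. The jumps lie at 1/4
  + Z/2, exactly where cos (2 pi x) changes sign, so the parity encodes that sign.\<close>

definition half_period :: "real \<Rightarrow> int" where
  "half_period x = \<lfloor>2 * x + 1 / 2\<rfloor>"

lemma half_period_bounds: "- (1/4) \<le> x - half_period x / 2" "x - half_period x / 2 < 1/4"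
  unfolding half_period_def by linarith+

lemma cos_half_period:
  "cos (2 * pi * x) = (if even (half_period x) then 1 else -1) * cos (2 * pi * (x - half_period x / 2))"
  using cos_add_int_pi[of "2 * pi * (x - half_period x / 2)" "half_period x"]
  by (auto simp: algebra_simps)

lemma cos_half_period_pos:
  assumes "cos (2 * pi * x) \<noteq> 0"
  shows "\<bar>x - half_period x / 2\<bar> < 1/4" "cos (2 * pi * (x - half_period x / 2)) > 0"
proof -
  have "x - half_period x / 2 \<noteq> - (1/4)"
  proof
    assume *: "x - half_period x / 2 = - (1/4)"
    have "cos (2 * pi * (x - half_period x / 2)) = 0" unfolding * by simp
    then show False using assms cos_half_period[of x] by simp
  qed
  then show *: "\<bar>x - half_period x / 2\<bar> < 1/4" using half_period_bounds[of x] by linarith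
  show "cos (2 * pi * (x - half_period x / 2)) > 0"
  proof (rule cos_gt_zero_pi)
    have "pi * (- (1/4)) < pi * (x - half_period x / 2)" "pi * (x - half_period x / 2) < pi * (1/4)"
      using * by (intro mult_strict_left_mono; simp; linarith)+
    then show "- (pi / 2) < 2 * pi * (x - half_period x / 2)" "2 * pi * (x - half_period x / 2) < pi / 2"
      by linarith+
  qed
qed

lemma sign_half_period:
  assumes "cos (2 * pi * x) \<noteq> 0"
  shows "sign_pm (cos (2 * pi * x)) = (if even (half_period x) then 1 else -1)"
  using cos_half_period[of x] cos_half_period_pos(2)[OF assms] by (auto simp: sign_pm_def)

lemma square_wave_sums:
  assumes "cos (2 * pi * x) \<noteq> 0"
  shows "(\<lambda>j. (-1) ^ j / (2 * real j + 1) * cos (2 * pi * (2 * real j + 1) * x)) sums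
           (pi / 4 * sign_pm (cos (2 * pi * x)))"
proof -
  define J where "J = half_period x"
  define y where "y = x - J / 2"
  define e :: real where "e = (if even J then 1 else -1)"
  have y: "\<bar>y\<bar> < 1/4" using cos_half_period_pos[OF assms] by (simp add: y_def J_def)
  then have "\<bar>2 * pi * y\<bar> < pi / 2" by (simp add: abs_mult)
  from sums_mult[OF square_wave_sums_central[OF this], of e]
  have "(\<lambda>j. e * ((-1) ^ j / (2 * real j + 1) * cos ((2 * real j + 1) * (2 * pi * y)))) sums (e * (pi / 4))" .
  \<comment> \<open>As 2 j + 1 is odd, (2 j + 1) J has the parity of J: every odd harmonic changes
    sign together with the wave itself.\<close>
  moreover have "cos (2 * pi * (2 * real j + 1) * x) = e * cos ((2 * real j + 1) * (2 * pi * y))" for j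
    using cos_add_int_pi[of "(2 * real j + 1) * (2 * pi * y)" "(2 * int j + 1) * J"]
    by (auto simp: y_def e_def algebra_simps)
  ultimately show ?thesis
    using sign_half_period[OF assms] by (simp add: e_def J_def mult_ac split: if_splits)
qed

text \<open>The continuous primitive of \<open>sign_pm (cos (2 * pi * x))\<close> that vanishes at
  0; its values lie in [-1/4, 1/4].\<close>

definition triangle_wave :: "real \<Rightarrow> real" where
  "triangle_wave x = (if even (half_period x) then 1 else -1) * (x - half_period x / 2)"

lemma half_period_mono: "x \<le> y \<Longrightarrow> half_period x \<le> half_period y"
  unfolding half_period_def by (intro floor_mono) simp

lemma triangle_wave_lipschitz: "\<bar>triangle_wave y - triangle_wave x\<bar> \<le> \<bar>y - x\<bar>"
proof -
  have *: "\<bar>triangle_wave y - triangle_wave x\<bar> \<le> y - x" if le: "x \<le> y" for x y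
  proof -
    note b = half_period_bounds[of x] half_period_bounds[of y]
    consider "half_period y = half_period x" | "half_period y = half_period x + 1"
      | "half_period y \<ge> half_period x + 2"
      using half_period_mono[OF le] by linarith
    then show ?thesis
    proof cases
      case 1
      then show ?thesis using le by (auto simp: triangle_wave_def)
    next
      case 2
      then show ?thesis using le b by (auto simp: triangle_wave_def abs_if field_simps)
    next
      case 3
      \<comment> \<open>Indices at least two apart force y - x > 1/2, which is the full oscillation
        of the wave.\<close>
      have "\<bar>triangle_wave z\<bar> \<le> 1/4" for z
      proof -
        have "\<bar>z - half_period z / 2\<bar> \<le> 1/4" using half_period_bounds[of z] by linarith
        then show ?thesis by (simp add: triangle_wave_def abs_mult)
      qed
      from this[of x] this[of y] 3 b show ?thesis by linarith
    qed
  qed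
  show ?thesis using *[of x y] *[of y x] by linarith
qed

text \<open>The increment is exact if no sign change separates x from y; otherwise the trivial bound
  2 (y - x) is used. Writing the error as a multiple of the increment of \<open>half_period\<close>
  makes it telescope over adjacent intervals.\<close>

lemma triangle_wave_step:
  assumes "x \<le> z" "z \<le> y" "cos (2 * pi * z) \<noteq> 0"
  shows "\<bar>triangle_wave y - triangle_wave x - (y - x) * sign_pm (cos (2 * pi * z))\<bar>
           \<le> 2 * (y - x) * (of_int (half_period y) - of_int (half_period x))"
proof (cases "half_period y = half_period x")
  case True
  then have "half_period z = half_period x"
    using half_period_mono[OF assms(1)] half_period_mono[OF assms(2)] by linarith
  then show ?thesis using True sign_half_period[OF assms(3)]
    by (auto simp: triangle_wave_def algebra_simps)
next
  case False
  then have "half_period y \<ge> half_period x + 1"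
    using half_period_mono[of x y] assms by linarith
  then have le: "2 * (y - x) * 1 \<le> 2 * (y - x) * (of_int (half_period y) - of_int (half_period x))"
    using assms by (intro mult_left_mono) auto
  have "\<bar>triangle_wave y - triangle_wave x - (y - x) * sign_pm (cos (2 * pi * z))\<bar>
      \<le> \<bar>triangle_wave y - triangle_wave x\<bar> + \<bar>(y - x) * sign_pm (cos (2 * pi * z))\<bar>"
    by (rule abs_triangle_ineq4)
  also have "\<bar>(y - x) * sign_pm (cos (2 * pi * z))\<bar> = y - x"
    using assms by (simp add: sign_pm_def)
  also have "\<bar>triangle_wave y - triangle_wave x\<bar> + (y - x) \<le> 2 * (y - x) * 1"
    using triangle_wave_lipschitz[of y x] assms by simp
  also note le
  finally show ?thesis .
qed

text \<open>For odd d the points d/4 and -d/4 are extrema of opposite sign, for even d they are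
  zeros. This is the source of the parity indicator in the formula for small multipliers.\<close>

lemma triangle_wave_quarter:
  "\<bar>triangle_wave (of_int d / 4) - triangle_wave (- (of_int d / 4))\<bar> = (if odd d then 1/2 else 0)"
proof (cases "even d")
  case True
  then obtain e where d: "d = 2 * e" by auto
  have "half_period (of_int d / 4) = e" "half_period (- (of_int d / 4)) = - e"
    unfolding half_period_def by (simp_all add: floor_eq_iff d)
  then show ?thesis using d by (simp add: triangle_wave_def)
next
  case False
  then obtain e where d: "d = 2 * e + 1" by (auto elim: oddE)
  \<comment> \<open>Both points lie on a boundary, and \<open>half_period\<close> assigns each to
    the half-period on its right; hence e + 1 on one side and - e on the other.\<close>
  have "half_period (of_int d / 4) = e + 1" "half_period (- (of_int d / 4)) = - e"
    unfolding half_period_def by (simp_all add: floor_eq_iff d field_simps)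
  then show ?thesis using d by (simp add: triangle_wave_def field_simps)
qed

section \<open>The square wave on residues modulo an odd number\<close>

lemma sum_residues_affine:
  fixes G :: "int \<Rightarrow> real"
  assumes per: "\<And>k m. G (k + m * N) = G k" and N: "N > 0" and a: "coprime a N"
  shows "(\<Sum>k\<in>{0..<N}. G (a * k + t)) = (\<Sum>k\<in>{0..<N}. G k)"
proof -
  have mod: "G (x mod N) = G x" for x
    using per[of x "- (x div N)"] by (simp add: minus_div_mult_eq_mod[symmetric])
  have inj: "inj_on (\<lambda>k. (a * k + t) mod N) {0..<N}"
  proof (rule inj_onI)
    fix x y assume x: "x \<in> {0..<N}" and y: "y \<in> {0..<N}"
      and "(a * x + t) mod N = (a * y + t) mod N"
    then have "[a * x = a * y] (mod N)"
      by (simp add: cong_def[symmetric] cong_add_rcancel)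
    then have "[x = y] (mod N)" using a by (simp add: cong_mult_lcancel)
    then show "x = y" using x y by (simp add: cong_def)
  qed
  moreover have "(\<lambda>k. (a * k + t) mod N) ` {0..<N} \<subseteq> {0..<N}" using N by auto
  ultimately have "bij_betw (\<lambda>k. (a * k + t) mod N) {0..<N} {0..<N}"
    unfolding bij_betw_def using endo_inj_surj by blast
  from sum.reindex_bij_betw[OF this, of G] show ?thesis by (simp add: mod)
qed

lemma sum_residues_window:
  fixes G :: "int \<Rightarrow> real"
  assumes per: "\<And>k m. G (k + m * N) = G k" and N: "N > 0"
  shows "(\<Sum>k\<in>{t..<t + N}. G k) = (\<Sum>k\<in>{0..<N}. G k)"
proof -
  have "(\<Sum>k\<in>{t..<t + N}. G k) = (\<Sum>k\<in>{0..<N}. G (1 * k + t))"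
    by (rule sum.reindex_bij_witness[of _ "\<lambda>k. k + t" "\<lambda>k. k - t"]) auto
  then show ?thesis using sum_residues_affine[OF per N, of 1 t] by simp
qed

text \<open>Oddness of n prevents 4 k from being a multiple of n by an odd factor, so no point 2 pi
  k / n is a zero of the cosine and each sign is determined by the window [-r, r].\<close>

locale odd_modulus =
  fixes n :: nat
  assumes odd_n: "odd n" and n_gt_1: "n > 1"
begin

definition cs :: "int \<Rightarrow> real" where "cs k = cos (2 * pi / real n * of_int k)"
definition sn :: "int \<Rightarrow> real" where "sn k = sin (2 * pi / real n * of_int k)"
definition f :: "int \<Rightarrow> real" where "f k = sign_pm (cs k)"
definition F :: "int \<Rightarrow> real" where "F j = (\<Sum>k\<in>{0..<int n}. f k * cs (j * k))"
definition r :: int where "r = int n div 4"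

lemma cs_add: "cs (x + y) = cs x * cs y - sn x * sn y"
  and cs_diff: "cs (x - y) = cs x * cs y + sn x * sn y"
  by (simp_all add: cs_def sn_def distrib_left right_diff_distrib cos_add cos_diff)

lemma cs_minus [simp]: "cs (- x) = cs x" and sn_minus [simp]: "sn (- x) = - sn x"
  by (simp_all add: cs_def sn_def)

lemma period_arg: "2 * pi / real n * of_int (k + m * int n) = 2 * pi / real n * of_int k + 2 * pi * of_int m"
  using n_gt_1 by (simp add: field_simps)

lemma cs_periodic: "cs (k + m * int n) = cs k" and sn_periodic: "sn (k + m * int n) = sn k"
  unfolding cs_def sn_def period_arg
  by (simp_all add: cos_add sin_add sin_integer_2pi cos_integer_2pi)

lemma cs_periodic': "cs (j * (k + m * int n)) = cs (j * k)" and sn_periodic': "sn (j * (k + m * int n)) = sn (j * k)"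
  using cs_periodic[of "j * k" "j * m"] sn_periodic[of "j * k" "j * m"] by (simp_all add: algebra_simps)

lemma f_periodic: "f (k + m * int n) = f k" by (simp add: f_def cs_periodic)
lemma f_periodic': "f (c * (k + m * int n)) = f (c * k)" by (simp add: f_def cs_periodic')
lemma f_minus [simp]: "f (- k) = f k" by (simp add: f_def)
lemma f_values: "f k = 1 \<or> f k = -1" by (simp add: f_def sign_pm_def)
lemma abs_f: "\<bar>f k\<bar> = 1" using f_values[of k] by auto

lemma n_pos: "int n > 0" "real n > 0" using n_gt_1 by auto

lemmas sum_affine = sum_residues_affine[OF _ n_pos(1)]
lemmas sum_window = sum_residues_window[OF _ n_pos(1)]

lemma cs_pos:
  assumes "\<bar>4 * k\<bar> < int n"
  shows "cs k > 0"
proof -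
  have "- (1/4) < of_int k / real n" "of_int k / real n < 1/4" using assms n_pos by (simp_all add: field_simps)
  then have "2 * pi * (- (1/4)) < 2 * pi * (of_int k / real n)" "2 * pi * (of_int k / real n) < 2 * pi * (1/4)"
    by (intro mult_strict_left_mono; simp)+
  then show ?thesis unfolding cs_def by (intro cos_gt_zero_pi) (simp_all add: field_simps)
qed

lemma cs_neg:
  assumes "int n < 4 * k" "4 * k < 3 * int n"
  shows "cs k < 0"
proof -
  have "1/4 < of_int k / real n" "of_int k / real n < 3/4" using assms n_pos by (simp_all add: field_simps)
  then have "2 * pi * (1/4) < 2 * pi * (of_int k / real n)" "2 * pi * (of_int k / real n) < 2 * pi * (3/4)"
    by (intro mult_strict_left_mono; simp)+
  then have "cos (2 * pi / real n * of_int k - pi) > 0" by (intro cos_gt_zero_pi) (simp_all add: field_simps)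
  then show ?thesis by (simp add: cs_def cos_diff)
qed

lemma r_bounds: "4 * r < int n" "int n < 4 * (r + 1)" "r \<ge> 0"
proof -
  have "4 * r \<noteq> int n" using odd_n by presburger
  moreover have "4 * r \<le> int n" "int n < 4 * (r + 1)" "r \<ge> 0" unfolding r_def by auto
  ultimately show "4 * r < int n" "int n < 4 * (r + 1)" "r \<ge> 0" by linarith+
qed

lemma f_inside: "- r \<le> k \<Longrightarrow> k \<le> r \<Longrightarrow> f k = 1"
  using cs_pos[of k] r_bounds by (force simp: f_def sign_pm_def)

lemma f_outside: "r < k \<Longrightarrow> k < int n - r \<Longrightarrow> f k = -1"
  using cs_neg[of k] r_bounds by (simp add: f_def sign_pm_def)

lemma cs_nonzero: "cs k \<noteq> 0"
proof -
  define k' where "k' = (k + r) mod int n - r"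
  have "k = k' + ((k + r) div int n) * int n"
    using div_mult_mod_eq[of "k + r" "int n"] by (simp add: k'_def algebra_simps)
  then have "cs k = cs k'" using cs_periodic by metis
  moreover have "- r \<le> k'" "k' < int n - r" using n_pos by (auto simp: k'_def)
  then have "cs k' \<noteq> 0" using cs_pos[of k'] cs_neg[of k'] r_bounds
    by (cases "k' \<le> r") force+
  ultimately show ?thesis by simp
qed

text \<open>Over the period starting at -r, f equals 2 * 1_[-r, r] - 1.\<close>

lemma sum_f_mult:
  assumes per: "\<And>k m. G (k + m * int n) = G k"
  shows "(\<Sum>k\<in>{0..<int n}. f k * G k) = 2 * (\<Sum>k\<in>{- r..r}. G k) - (\<Sum>k\<in>{0..<int n}. G k)"
proof -
  have split: "{- r..<- r + int n} = {- r..r} \<union> {r + 1..<int n - r}" "{- r..r} \<inter> {r + 1..<int n - r} = {}"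
    using r_bounds by auto
  have s: "(\<Sum>k\<in>{0..<int n}. H k) = (\<Sum>k\<in>{- r..r}. H k) + (\<Sum>k\<in>{r + 1..<int n - r}. H k)"
    if "\<And>k m. H (k + m * int n) = H k" for H :: "int \<Rightarrow> real"
    using sum_window[of H "- r", OF that] split by (simp add: sum.union_disjoint)
  have "(\<Sum>k\<in>{0..<int n}. f k * G k) = (\<Sum>k\<in>{- r..r}. f k * G k) + (\<Sum>k\<in>{r + 1..<int n - r}. f k * G k)"
    by (rule s) (simp add: per f_periodic)
  also have "(\<Sum>k\<in>{- r..r}. f k * G k) = (\<Sum>k\<in>{- r..r}. G k)"
    by (intro sum.cong) (auto simp: f_inside)
  also have "(\<Sum>k\<in>{r + 1..<int n - r}. f k * G k) = - (\<Sum>k\<in>{r + 1..<int n - r}. G k)"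
    unfolding sum_negf[symmetric] by (intro sum.cong) (auto simp: f_outside)
  finally show ?thesis using s[OF per] by simp
qed

lemma F_minus [simp]: "F (- j) = F j" by (simp add: F_def)

lemma F_periodic: "F (j + m * int n) = F j"
proof -
  have "cs ((j + m * int n) * k) = cs (j * k)" for k
    using cs_periodic[of "j * k" "m * k"] by (simp add: algebra_simps)
  then show ?thesis by (simp add: F_def)
qed

lemma F_abs_le: "\<bar>F j\<bar> \<le> n"
proof -
  have "\<bar>F j\<bar> \<le> (\<Sum>k\<in>{0..<int n}. \<bar>f k * cs (j * k)\<bar>)" unfolding F_def by (rule sum_abs)
  also have "\<dots> \<le> (\<Sum>k\<in>{0..<int n}. 1)" by (intro sum_mono) (simp add: abs_mult abs_f cs_def)
  finally show ?thesis by simp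
qed

lemma sum_f_sn: "(\<Sum>k\<in>{0..<int n}. f k * sn (j * k)) = 0"
proof -
  have "(\<Sum>k\<in>{0..<int n}. f (-1 * k + 0) * sn (j * (-1 * k + 0))) = (\<Sum>k\<in>{0..<int n}. f k * sn (j * k))"
    by (rule sum_affine) (simp_all add: f_periodic sn_periodic')
  then show ?thesis by (simp add: sum_negf)
qed

text \<open>n is 1 or 3 modulo 4, so the window of 2 r + 1 points has (n + 1)/2 or (n - 1)/2
  elements: f is balanced up to one.\<close>

lemma F_0: "\<bar>F 0\<bar> = 1"
proof -
  have "F 0 = 2 * (\<Sum>k\<in>{- r..r}. 1) - (\<Sum>k\<in>{0..<int n}. 1)"
    using sum_f_mult[of "\<lambda>_. 1"] by (simp add: F_def cs_def)
  also have "\<dots> = of_int (2 * (2 * r + 1) - int n)" using r_bounds by simp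
  finally have "\<bar>F 0\<bar> = of_int \<bar>2 * (2 * r + 1) - int n\<bar>" by simp
  moreover have "\<bar>2 * (2 * r + 1) - int n\<bar> = 1" using r_bounds odd_n by presburger
  ultimately show ?thesis by simp
qed

text \<open>Summation by parts: the square wave \<open>f\<close> has only the two jumps at \<open>r\<close> and \<open>n - 1 - r\<close>.\<close>

lemma F_sin: "F j * sin (pi * of_int j / real n) = 2 * sin (pi * of_int j * of_int (2 * r + 1) / real n)"
proof -
  \<comment> \<open>The half-integer shift makes h k - h (k - 1) a multiple of cs (j k), and makes h
    odd about -1/2, so that the boundary terms at r and -r - 1 reinforce each other.\<close>
  define h where "h k = sin (2 * pi / real n * of_int j * (of_int k + 1/2))" for k :: int
  have arg: "2 * pi / real n * of_int j * (of_int k + 1/2) = 2 * pi / real n * of_int (j * k) + pi * of_int j / real n"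
    for k by (simp add: ring_distribs)
  have h: "h k = sn (j * k) * cos (pi * of_int j / real n) + cs (j * k) * sin (pi * of_int j / real n)" for k
    unfolding h_def arg by (simp add: sin_add sn_def cs_def)
  have hper: "h (k + m * int n) = h k" for k m unfolding h by (simp add: sn_periodic' cs_periodic')
  have "h (k - 1) = sn (j * k) * cos (pi * of_int j / real n) - cs (j * k) * sin (pi * of_int j / real n)" for k
  proof -
    have "2 * pi / real n * of_int j * (of_int (k - 1) + 1/2) = 2 * pi / real n * of_int (j * k) - pi * of_int j / real n"
      by (simp add: ring_distribs)
    then show ?thesis unfolding h_def by (simp add: sin_diff sn_def cs_def)
  qed
  then have "h k - h (k - 1) = 2 * cs (j * k) * sin (pi * of_int j / real n)" for k by (simp add: h)
  then have "2 * (F j * sin (pi * of_int j / real n)) = (\<Sum>k\<in>{0..<int n}. f k * (h k - h (k - 1)))"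
    unfolding F_def by (simp add: sum_distrib_left sum_distrib_right mult_ac)
  also have "\<dots> = (\<Sum>k\<in>{0..<int n}. f k * h k) - (\<Sum>k\<in>{0..<int n}. f k * h (k - 1))"
    by (simp add: right_diff_distrib sum_subtractf)
  also have "(\<Sum>k\<in>{0..<int n}. f k * h k) = 2 * (\<Sum>k\<in>{- r..r}. h k) - (\<Sum>k\<in>{0..<int n}. h k)"
    by (rule sum_f_mult) (rule hper)
  also have "(\<Sum>k\<in>{0..<int n}. f k * h (k - 1)) = 2 * (\<Sum>k\<in>{- r..r}. h (k - 1)) - (\<Sum>k\<in>{0..<int n}. h (k - 1))"
  proof (rule sum_f_mult)
    show "h (k + m * int n - 1) = h (k - 1)" for k m using hper[of "k - 1" m] by (simp add: algebra_simps)
  qed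
  also have "(\<Sum>k\<in>{0..<int n}. h (k - 1)) = (\<Sum>k\<in>{0..<int n}. h k)"
    using sum_affine[of h 1 "-1", OF hper] by simp
  also have "(\<Sum>k\<in>{- r..r}. h (k - 1)) = (\<Sum>k\<in>{- r - 1..r - 1}. h k)"
    by (rule sum.reindex_bij_witness[of _ "\<lambda>k. k + 1" "\<lambda>k. k - 1"]) auto
  also have "(\<Sum>k\<in>{- r..r}. h k) = (\<Sum>k\<in>{- r..r - 1}. h k) + h r"
  proof -
    have "{- r..r} = insert r {- r..r - 1}" using r_bounds by auto
    then show ?thesis by simp
  qed
  also have "(\<Sum>k\<in>{- r - 1..r - 1}. h k) = h (- r - 1) + (\<Sum>k\<in>{- r..r - 1}. h k)"
  proof -
    have "{- r - 1..r - 1} = insert (- r - 1) {- r..r - 1}" using r_bounds(3) by auto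
    then show ?thesis by simp
  qed
  also have "h (- r - 1) = - h r"
    unfolding h_def sin_minus[symmetric] using n_pos by (intro arg_cong[of _ _ sin]) (simp add: field_simps)
  also have "h r = sin (pi * of_int j * of_int (2 * r + 1) / real n)"
    unfolding h_def using n_pos by (intro arg_cong[of _ _ sin]) (simp add: field_simps)
  finally show ?thesis by simp
qed

end

section \<open>Autocorrelation of the tent function\<close>

lemma sum_telescope_int:
  fixes H P :: "int \<Rightarrow> real"
  assumes "x \<le> y + 1" "\<And>i. x \<le> i \<Longrightarrow> i \<le> y \<Longrightarrow> P i = H (i + 1) - H i"
  shows "(\<Sum>i\<in>{x..y}. P i) = H (y + 1) - H x"
  using assms
proof (induction "nat (y + 1 - x)" arbitrary: y)
  case 0
  then have "{x..y} = {}" "y + 1 = x" by auto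
  then show ?case by simp
next
  case (Suc m)
  have "{x..y} = insert y {x..y - 1}" using Suc by auto
  moreover have "(\<Sum>i\<in>{x..y - 1}. P i) = H (y - 1 + 1) - H x"
    using Suc by (intro Suc.hyps(1)) auto
  ultimately show ?case using Suc by simp
qed

lemma sum_symmetric_int:
  fixes H :: "int \<Rightarrow> real"
  assumes "\<And>l. H (- l) = H l"
  shows "(\<Sum>l\<in>{- int N..int N}. H l) = H 0 + 2 * (\<Sum>l = 1..N. H (int l))"
proof (induction N)
  case (Suc N)
  have "{- int (Suc N)..int (Suc N)} = insert (- int (Suc N)) (insert (int (Suc N)) {- int N..int N})"
    by auto
  then show ?case using Suc assms[of "int (Suc N)"] by simp
qed simp

definition tent :: "nat \<Rightarrow> int \<Rightarrow> real" where
  "tent q i = max 0 (real q - \<bar>of_int i\<bar>)"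

text \<open>Up to normalisation, \<open>tent q\<close> holds the coefficients of the Fejer kernel
  and \<open>tent_conv q\<close> those of its square. The sum may stop at q because
  \<open>tent q\<close> vanishes from there on.\<close>

definition tent_conv :: "nat \<Rightarrow> int \<Rightarrow> real" where
  "tent_conv q l = (\<Sum>i\<in>{- int q..int q}. tent q i * tent q (l - i))"

lemma tent_minus [simp]: "tent q (- i) = tent q i" by (simp add: tent_def)
lemma tent_nonneg [simp]: "tent q i \<ge> 0" by (simp add: tent_def)
lemma tent_eq_0: "\<bar>i\<bar> \<ge> int q \<Longrightarrow> tent q i = 0"
proof -
  assume "\<bar>i\<bar> \<ge> int q"
  then have "\<bar>real_of_int i\<bar> \<ge> real q" by linarith
  then show ?thesis by (simp add: tent_def)
qed

lemma tent_conv_nonneg: "tent_conv q l \<ge> 0"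
  unfolding tent_conv_def by (intro sum_nonneg) simp

lemma tent_conv_minus [simp]: "tent_conv q (- l) = tent_conv q l"
  unfolding tent_conv_def
proof (rule sum.reindex_bij_witness[of _ uminus uminus])
  fix i show "tent q (- i) * tent q (l - - i) = tent q i * tent q (- l - i)"
    using tent_minus[of q "l + i"] by simp
qed auto

text \<open>\<open>tent q\<close> lives on |i| <= q - 1, so the kernel has degree 2 q - 2, always an
  even number.\<close>

lemma tent_conv_eq_0: "\<bar>l\<bar> \<ge> 2 * int q - 1 \<Longrightarrow> tent_conv q l = 0"
  unfolding tent_conv_def
proof (rule sum.neutral, rule ballI)
  fix i assume "\<bar>l\<bar> \<ge> 2 * int q - 1" "i \<in> {- int q..int q}"
  then have "\<bar>i\<bar> \<ge> int q \<or> \<bar>l - i\<bar> \<ge> int q" by auto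
  then show "tent q i * tent q (l - i) = 0" using tent_eq_0 by auto
qed

lemma tent_conv_le: "tent_conv q l \<le> tent_conv q 0"
proof -
  let ?I = "{- int q..int q}"
  have "tent_conv q l \<le> (\<Sum>i\<in>?I. (tent q i * tent q i + tent q (l - i) * tent q (l - i)) / 2)"
    unfolding tent_conv_def
  proof (rule sum_mono)
    fix i
    show "tent q i * tent q (l - i) \<le> (tent q i * tent q i + tent q (l - i) * tent q (l - i)) / 2"
      using sum_squares_bound[of "tent q i" "tent q (l - i)"] by (simp add: power2_eq_square)
  qed
  also have "\<dots> = ((\<Sum>i\<in>?I. tent q i * tent q i) + (\<Sum>i\<in>?I. tent q (l - i) * tent q (l - i))) / 2"
    by (simp add: sum.distrib sum_divide_distrib[symmetric])
  also have "(\<Sum>i\<in>?I. tent q (l - i) * tent q (l - i)) = (\<Sum>i\<in>{l - int q..l + int q}. tent q i * tent q i)"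
    by (rule sum.reindex_bij_witness[of _ "\<lambda>i. l - i" "\<lambda>i. l - i"]) auto
  also have "\<dots> = (\<Sum>i\<in>{l - int q..l + int q} \<inter> ?I. tent q i * tent q i)"
    by (rule sum.mono_neutral_right) (auto intro!: tent_eq_0)
  also have "\<dots> \<le> (\<Sum>i\<in>?I. tent q i * tent q i)"
    by (rule sum_mono2) auto
  finally show ?thesis by (simp add: tent_conv_def)
qed

text \<open>The corners of the two tents cut the range at i = 0 and i = l; on each piece the product
  is a quadratic in i, with \<open>H1\<close>, \<open>H2\<close>, \<open>H3\<close> as discrete
  antiderivatives. For l > q the pieces are arranged differently.\<close>

lemma tent_conv_formula:
  assumes "0 \<le> l" "l \<le> int q"
  shows "tent_conv q l = real q * (2 * (real q)\<^sup>2 + 1) / 3 - real q * (of_int l)\<^sup>2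
           + ((of_int l) ^ 3 - of_int l) / 2"
proof -
  define x where "x = real q"
  define y where "y = real_of_int l"
  define H1 where "H1 i = of_int i * (of_int i - 1) * (2 * of_int i - 1) / 6
     + (2 * x - y) * (of_int i * (of_int i - 1)) / 2 + x * (x - y) * of_int i" for i :: int
  define H2 where "H2 i = - (of_int i * (of_int i - 1) * (2 * of_int i - 1)) / 6
     + y * (of_int i * (of_int i - 1)) / 2 + x * (x - y) * of_int i" for i :: int
  define H3 where "H3 i = of_int i * (of_int i - 1) * (2 * of_int i - 1) / 6
     - (2 * x + y) * (of_int i * (of_int i - 1)) / 2 + x * (x + y) * of_int i" for i :: int
  let ?g = "\<lambda>i. tent q i * tent q (l - i)"
  have I: "{- int q..int q} = {- int q..l - int q - 1} \<union> ({l - int q..-1} \<union> ({0..l} \<union> {l + 1..int q}))"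
    using assms by auto
  have "tent_conv q l = sum ?g {- int q..l - int q - 1} + (sum ?g {l - int q..-1} + (sum ?g {0..l} + sum ?g {l + 1..int q}))"
    unfolding tent_conv_def I using assms by (simp add: sum.union_disjoint Int_Un_distrib)
  also have "sum ?g {- int q..l - int q - 1} = 0"
    by (rule sum.neutral) (auto intro!: tent_eq_0)
  also have "sum ?g {l - int q..-1} = H1 (-1 + 1) - H1 (l - int q)"
  proof (rule sum_telescope_int)
    fix i assume i: "l - int q \<le> i" "i \<le> -1"
    then have "tent q i = x + of_int i" "tent q (l - i) = x - y + of_int i"
      using assms by (auto simp: tent_def x_def y_def)
    then have "?g i = (x + of_int i) * (x - y + of_int i)" by simp
    also have "\<dots> = H1 (i + 1) - H1 i" by (simp add: H1_def field_simps)
    finally show "?g i = H1 (i + 1) - H1 i" .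
  qed (use assms in auto)
  also have "sum ?g {0..l} = H2 (l + 1) - H2 0"
  proof (rule sum_telescope_int)
    fix i assume i: "0 \<le> i" "i \<le> l"
    then have "tent q i = x - of_int i" "tent q (l - i) = x - y + of_int i"
      using assms by (auto simp: tent_def x_def y_def)
    then have "?g i = (x - of_int i) * (x - y + of_int i)" by simp
    also have "\<dots> = H2 (i + 1) - H2 i" by (simp add: H2_def field_simps)
    finally show "?g i = H2 (i + 1) - H2 i" .
  qed (use assms in auto)
  also have "sum ?g {l + 1..int q} = H3 (int q + 1) - H3 (l + 1)"
  proof (rule sum_telescope_int)
    fix i assume i: "l + 1 \<le> i" "i \<le> int q"
    then have "tent q i = x - of_int i" "tent q (l - i) = x + y - of_int i"
      using assms by (auto simp: tent_def x_def y_def)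
    then have "?g i = (x - of_int i) * (x + y - of_int i)" by simp
    also have "\<dots> = H3 (i + 1) - H3 i" by (simp add: H3_def field_simps)
    finally show "?g i = H3 (i + 1) - H3 i" .
  qed (use assms in auto)
  finally show ?thesis
    by (simp add: H1_def H2_def H3_def x_def[symmetric] y_def[symmetric] field_simps
        power2_eq_square power3_eq_cube)
qed

context odd_modulus
begin

section \<open>Sizes of the Fourier coefficients\<close>

text \<open>With x = pi l / (2 n) and 2 r + 1 = (n + \<epsilon>) / 2, the formula
  \<open>F_sin\<close> has numerator 2 sin (pi l / 2 + \<epsilon> x) and denominator 2 sin x cos x.
  The parity of l decides which factor cancels, and squaring removes the sign.\<close>

lemma F_squared:
  assumes "0 < l" "l < int n"
  shows "(F l)\<^sup>2 = 1 / (if odd l then (sin (pi * l / (2 * n)))\<^sup>2 else (cos (pi * l / (2 * n)))\<^sup>2)"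
proof -
  define x where "x = pi * of_int l / (2 * n)"
  have "0 < x" using assms n_pos by (simp add: x_def)
  moreover have "pi * of_int l / (2 * n) < pi * real n / (2 * n)"
    using assms n_pos by (intro divide_strict_right_mono mult_strict_left_mono) auto
  then have "x < pi / 2" using n_pos by (simp add: x_def)
  ultimately have pos: "sin x > 0" "cos x > 0" by (auto intro: sin_gt_zero cos_gt_zero_pi)
  obtain \<epsilon> :: real where \<epsilon>: "\<epsilon> = 1 \<or> \<epsilon> = -1" "of_int (2 * r + 1) = (real n + \<epsilon>) / 2"
  proof -
    have "2 * (2 * r + 1) = int n + 1 \<or> 2 * (2 * r + 1) = int n - 1" using r_bounds odd_n by presburger
    then have "real_of_int (2 * (2 * r + 1)) = real n + 1 \<or> real_of_int (2 * (2 * r + 1)) = real n - 1"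
      by linarith
    then show ?thesis using that[of 1] that[of "-1"] by auto
  qed
  have "F l * sin (2 * x) = 2 * sin (pi / 2 * of_int l + \<epsilon> * x)"
  proof -
    have "pi * of_int l / real n = 2 * x" by (simp add: x_def)
    moreover have "pi * of_int l * of_int (2 * r + 1) / real n = pi / 2 * of_int l + \<epsilon> * x"
      unfolding \<epsilon>(2) using n_pos by (simp add: x_def field_simps)
    ultimately show ?thesis using F_sin[of l] by simp
  qed
  then have "(F l * (2 * sin x * cos x))\<^sup>2 = (2 * sin (pi / 2 * of_int l + \<epsilon> * x))\<^sup>2"
    by (simp only: sin_double)
  then have *: "(F l)\<^sup>2 * ((sin x)\<^sup>2 * (cos x)\<^sup>2) = (sin (pi / 2 * of_int l + \<epsilon> * x))\<^sup>2"
    by (simp add: power_mult_distrib)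
  have "(cos (\<epsilon> * x))\<^sup>2 = (cos x)\<^sup>2" "(sin (\<epsilon> * x))\<^sup>2 = (sin x)\<^sup>2" using \<epsilon> by auto
  have e: "(sin (pi / 2 * of_int l + \<epsilon> * x))\<^sup>2 = (if odd l then (cos x)\<^sup>2 else (sin x)\<^sup>2)"
  proof (cases "even l")
    case True
    then obtain h where "l = 2 * h" by auto
    then have "pi / 2 * of_int l + \<epsilon> * x = \<epsilon> * x + of_int h * pi" by simp
    moreover have "(cos (\<epsilon> * x + of_int h * pi))\<^sup>2 = (cos x)\<^sup>2"
      unfolding cos_add_int_pi using \<epsilon> by auto
    ultimately have "(sin (pi / 2 * of_int l + \<epsilon> * x))\<^sup>2 = (sin x)\<^sup>2" by (simp only: sin_squared_eq)
    then show ?thesis using True by simp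
  next
    case False
    then obtain h where "l = 2 * h + 1" by (auto elim: oddE)
    then have "sin (pi / 2 * of_int l + \<epsilon> * x) = cos (\<epsilon> * x + of_int h * pi)"
      using sin_add[of "pi / 2" "\<epsilon> * x + of_int h * pi"] by (simp add: algebra_simps)
    then show ?thesis using False \<epsilon> cos_add_int_pi[of "\<epsilon> * x" h] by auto
  qed
  show ?thesis
    using * pos unfolding e x_def[symmetric] by (auto simp: divide_simps split: if_splits)
qed

text \<open>From sin x <= x. The lower bound is the square of n times the l-th coefficient 2 / (pi
  l) of the continuous square wave.\<close>

lemma F_squared_ge:
  assumes "0 < l" "l < int n" "odd l"
  shows "(F l)\<^sup>2 \<ge> 4 * (real n)\<^sup>2 / (pi\<^sup>2 * (of_int l)\<^sup>2)"
proof -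
  define x where "x = pi * of_int l / (2 * n)"
  have x: "0 < x" using assms n_pos by (simp add: x_def)
  have "pi * of_int l / (2 * n) < pi * real n / (2 * n)"
    using assms n_pos by (intro divide_strict_right_mono mult_strict_left_mono) auto
  then have "x < pi / 2" using n_pos by (simp add: x_def)
  then have pos: "sin x > 0" using x by (intro sin_gt_zero) auto
  then have "(sin x)\<^sup>2 \<le> x\<^sup>2" using sin_x_le_x[of x] x by (intro power_mono) auto
  then have "1 / x\<^sup>2 \<le> 1 / (sin x)\<^sup>2" using pos x by (intro divide_left_mono) auto
  moreover have "1 / x\<^sup>2 = 4 * (real n)\<^sup>2 / (pi\<^sup>2 * (of_int l)\<^sup>2)"
    by (simp add: x_def power_divide power_mult_distrib)
  ultimately show ?thesis using F_squared[of l] assms by (simp add: x_def)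
qed

text \<open>Even harmonics vanish for the continuous wave; discretisation leaves only 1 / cos x with
  x <= pi/3. The range extends beyond n/2 because the kernel may use one frequency just above
  n/2.\<close>

lemma F_abs_le_even:
  assumes "0 < l" "3 * l \<le> 2 * int n" "even l"
  shows "\<bar>F l\<bar> \<le> 2"
proof -
  define x where "x = pi * of_int l / (2 * n)"
  have x: "0 < x" using assms n_pos by (simp add: x_def)
  have "of_int l / (2 * real n) \<le> 1/3" using assms n_pos by (simp add: field_simps)
  then have "pi * (of_int l / (2 * real n)) \<le> pi * (1/3)" by (intro mult_left_mono) auto
  then have "x \<le> pi / 3" by (simp add: x_def)
  then have "cos x \<ge> cos (pi / 3)" using x by (intro cos_monotone_0_pi_le) auto
  then have c: "cos x \<ge> 1/2" by (simp add: cos_60)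
  have "(F l)\<^sup>2 = (1 / cos x)\<^sup>2" using F_squared[of l] assms by (simp add: x_def power_divide)
  then have "\<bar>F l\<bar> = \<bar>1 / cos x\<bar>" by (simp only: power2_eq_iff abs_eq_iff)
  also have "\<dots> = 1 / cos x" using c by simp
  also have "\<dots> \<le> 1 / (1/2)" using c by (intro divide_left_mono) auto
  finally show ?thesis by simp
qed

lemma F_abs_le_odd:
  assumes "0 < l" "l < int n" "odd l"
  shows "\<bar>F l\<bar> \<le> 2 * n / of_int l"
proof -
  define x where "x = pi * of_int l / (2 * n)"
  have x: "0 < x" using assms n_pos by (simp add: x_def)
  have "pi * of_int l / (2 * n) < pi * real n / (2 * n)"
    using assms n_pos by (intro divide_strict_right_mono mult_strict_left_mono) auto
  then have "x < pi / 2" using n_pos by (simp add: x_def)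
  then have "sin x \<ge> x / 3" using x by (intro sin_ge_third) auto
  moreover have "x / 3 \<ge> of_int l / (2 * n)"
    using pi_ge_3 assms n_pos by (simp add: x_def field_simps)
  ultimately have s: "sin x \<ge> of_int l / (2 * n)" by linarith
  have p: "of_int l / (2 * n) > 0" using assms n_pos by simp
  then have sp: "sin x > 0" using s by linarith
  have "(F l)\<^sup>2 = (1 / sin x)\<^sup>2" using F_squared[of l] assms by (simp add: x_def power_divide)
  then have "\<bar>F l\<bar> = \<bar>1 / sin x\<bar>" by (simp only: power2_eq_iff abs_eq_iff)
  also have "\<dots> = 1 / sin x" using s p by simp
  also have "\<dots> \<le> 1 / (of_int l / (2 * n))" using s p sp by (intro divide_left_mono mult_pos_pos) auto
  finally show ?thesis by simp
qed

lemma F_abs_le_half: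
  assumes "0 < l" "2 * l \<le> int n"
  shows "\<bar>F l\<bar> \<le> 2 * n / of_int l"
proof (cases "odd l")
  case True
  then show ?thesis using assms by (intro F_abs_le_odd) auto
next
  case False
  then have "\<bar>F l\<bar> \<le> 2" using assms by (intro F_abs_le_even) auto
  also have "2 \<le> 2 * n / of_int l" using assms by (simp add: field_simps)
  finally show ?thesis .
qed

lemma F_abs_le_norm:
  assumes "0 < j" "j < int n"
  shows "\<bar>F j\<bar> \<le> 2 * n / of_int (min j (int n - j))"
proof (cases "2 * j \<le> int n")
  case True
  then show ?thesis using assms F_abs_le_half[of j] by (simp add: min_def)
next
  case False
  have "F j = F (int n - j)" using F_periodic[of "- j" 1] by simp
  then show ?thesis using assms False F_abs_le_half[of "int n - j"] by (simp add: min_def)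
qed


section \<open>Smoothing the correlation\<close>

text \<open>The sum to be estimated is the value at t = 0; the shift t is there to be averaged over.
  For c = 1 this is the autocorrelation of f, which measures the cost of a shift.\<close>

definition corr :: "int \<Rightarrow> int \<Rightarrow> real" where
  "corr c t = (\<Sum>k\<in>{0..<int n}. f k * f (c * k - t))"

definition kernel :: "nat \<Rightarrow> int \<Rightarrow> real" where
  "kernel q t = (\<Sum>l\<in>{- int (2 * q)..int (2 * q)}. tent_conv q l * cs (l * t))"

lemma kernel_nonneg: "kernel q t \<ge> 0"
proof -
  let ?I = "{- int q..int q}" and ?L = "{- int (2 * q)..int (2 * q)}"
  have sn0: "(\<Sum>j\<in>?I. tent q j * sn (j * t)) = 0"
  proof -
    have "(\<Sum>j\<in>?I. tent q j * sn (j * t)) = (\<Sum>j\<in>?I. - (tent q j * sn (j * t)))"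
      by (rule sum.reindex_bij_witness[of _ uminus uminus]) auto
    then show ?thesis by (simp add: sum_negf)
  qed
  have "kernel q t = (\<Sum>i\<in>?I. \<Sum>l\<in>?L. tent q i * (tent q (l - i) * cs (l * t)))"
    unfolding kernel_def tent_conv_def sum_distrib_right by (subst sum.swap) (simp add: mult.assoc)
  also have "\<dots> = (\<Sum>i\<in>?I. tent q i * ((\<Sum>j\<in>?I. tent q j * cs (j * t)) * cs (i * t)))"
  proof (rule sum.cong[OF refl])
    fix i assume i: "i \<in> ?I"
    have "(\<Sum>l\<in>?L. tent q (l - i) * cs (l * t)) = (\<Sum>l\<in>{i - int q..i + int q}. tent q (l - i) * cs (l * t))"
      using i by (intro sum.mono_neutral_right) (auto intro!: tent_eq_0)
    also have "\<dots> = (\<Sum>j\<in>?I. tent q j * cs ((i + j) * t))"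
      by (rule sum.reindex_bij_witness[of _ "\<lambda>j. i + j" "\<lambda>l. l - i"]) auto
    also have "\<dots> = (\<Sum>j\<in>?I. tent q j * cs (j * t)) * cs (i * t) - (\<Sum>j\<in>?I. tent q j * sn (j * t)) * sn (i * t)"
      unfolding sum_distrib_right sum_subtractf[symmetric]
      by (intro sum.cong) (simp_all add: cs_add algebra_simps)
    finally show "(\<Sum>l\<in>?L. tent q i * (tent q (l - i) * cs (l * t))) = tent q i * ((\<Sum>j\<in>?I. tent q j * cs (j * t)) * cs (i * t))"
      by (simp add: sum_distrib_left[symmetric] sn0)
  qed
  also have "\<dots> = (\<Sum>j\<in>?I. tent q j * cs (j * t))\<^sup>2"
    by (simp add: power2_eq_square sum_distrib_left sum_distrib_right mult_ac)
  finally show ?thesis by simp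
qed

text \<open>The shift t -> t + 1 preserves the sum but, by the addition theorem, multiplies it by cs
  l, because the sine sum vanishes by oddness; and cs l = 1 only for multiples of n.\<close>

lemma sum_cs_eq_0:
  assumes "\<not> int n dvd l"
  shows "(\<Sum>t\<in>{0..<int n}. cs (l * t)) = 0"
proof -
  let ?X = "\<Sum>t\<in>{0..<int n}. cs (l * t)" and ?Y = "\<Sum>t\<in>{0..<int n}. sn (l * t)"
  have "(\<Sum>t\<in>{0..<int n}. sn (l * (-1 * t + 0))) = ?Y"
    by (rule sum_affine) (simp_all add: sn_periodic')
  then have Y: "?Y = 0" by (simp add: sum_negf)
  have "(\<Sum>t\<in>{0..<int n}. cs (l * (1 * t + 1))) = ?X"
    by (rule sum_affine) (simp_all add: cs_periodic')
  moreover have "(\<Sum>t\<in>{0..<int n}. cs (l * (1 * t + 1))) = ?X * cs l - ?Y * sn l"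
    unfolding sum_distrib_right sum_subtractf[symmetric]
    by (intro sum.cong) (simp_all add: distrib_left cs_add)
  ultimately have "?X * (1 - cs l) = 0" using Y by (simp add: algebra_simps)
  moreover have "cs l \<noteq> 1"
  proof
    assume "cs l = 1"
    then obtain m :: int where "2 * pi / real n * of_int l = of_int m * 2 * pi"
      unfolding cs_def cos_one_2pi_int by auto
    then have "real_of_int l = of_int (m * int n)" using n_pos by (simp add: field_simps)
    then have "l = m * int n" by linarith
    then show False using assms by simp
  qed
  ultimately show ?thesis by simp
qed

text \<open>The bound on q keeps every nonzero frequency of the kernel below n in modulus, so none
  of them is aliased to 0.\<close>

lemma sum_kernel:
  assumes "2 * int q - 1 \<le> int n"
  shows "(\<Sum>t\<in>{0..<int n}. kernel q t) = n * tent_conv q 0"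
proof -
  have "(\<Sum>t\<in>{0..<int n}. kernel q t) = (\<Sum>l\<in>{- int (2 * q)..int (2 * q)}. tent_conv q l * (\<Sum>t\<in>{0..<int n}. cs (l * t)))"
    unfolding kernel_def sum_distrib_left by (rule sum.swap)
  also have "\<dots> = (\<Sum>l\<in>{0}. tent_conv q l * (\<Sum>t\<in>{0..<int n}. cs (l * t)))"
  proof (rule sum.mono_neutral_right)
    show "\<forall>l\<in>{- int (2 * q)..int (2 * q)} - {0}. tent_conv q l * (\<Sum>t\<in>{0..<int n}. cs (l * t)) = 0"
    proof
      fix l assume l: "l \<in> {- int (2 * q)..int (2 * q)} - {0}"
      show "tent_conv q l * (\<Sum>t\<in>{0..<int n}. cs (l * t)) = 0"
      proof (cases "\<bar>l\<bar> \<ge> 2 * int q - 1")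
        case True
        then show ?thesis by (simp add: tent_conv_eq_0)
      next
        case False
        then have "\<not> int n dvd l" using assms l by (auto dest: dvd_imp_le_int)
        then show ?thesis by (simp add: sum_cs_eq_0)
      qed
    qed
  qed auto
  finally show ?thesis by (simp add: cs_def)
qed

text \<open>Convolution theorem on the residues modulo n; the sine parts drop out because f is
  even.\<close>

lemma sum_cs_corr: "(\<Sum>t\<in>{0..<int n}. cs (l * t) * corr c t) = F l * F (l * c)"
proof -
  have inner: "(\<Sum>t\<in>{0..<int n}. cs (l * t) * f (c * k - t)) = cs (l * c * k) * F l" for k
  proof -
    let ?G = "\<lambda>u. f u * cs (l * (c * k - u))"
    have "(\<Sum>t\<in>{0..<int n}. ?G (-1 * t + c * k)) = (\<Sum>u\<in>{0..<int n}. ?G u)"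
    proof (rule sum_affine)
      show "?G (u + m * int n) = ?G u" for u m
        using cs_periodic'[of l "c * k - u" "- m"] by (simp add: f_periodic algebra_simps)
    qed simp
    then have "(\<Sum>t\<in>{0..<int n}. cs (l * t) * f (c * k - t)) = (\<Sum>u\<in>{0..<int n}. ?G u)"
      by (simp add: mult.commute)
    also have "\<dots> = (\<Sum>u\<in>{0..<int n}. cs (l * c * k) * (f u * cs (l * u)) + sn (l * c * k) * (f u * sn (l * u)))"
      by (intro sum.cong) (simp_all add: right_diff_distrib cs_diff algebra_simps)
    also have "\<dots> = cs (l * c * k) * F l + sn (l * c * k) * (\<Sum>u\<in>{0..<int n}. f u * sn (l * u))"
      by (simp add: sum.distrib sum_distrib_left F_def)
    finally show ?thesis by (simp add: sum_f_sn)
  qed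
  have "(\<Sum>t\<in>{0..<int n}. cs (l * t) * corr c t) = (\<Sum>t\<in>{0..<int n}. \<Sum>k\<in>{0..<int n}. f k * (cs (l * t) * f (c * k - t)))"
    unfolding corr_def sum_distrib_left by (simp add: mult_ac)
  also have "\<dots> = (\<Sum>k\<in>{0..<int n}. f k * (\<Sum>t\<in>{0..<int n}. cs (l * t) * f (c * k - t)))"
    unfolding sum_distrib_left by (rule sum.swap)
  also have "\<dots> = F l * F (l * c)"
    unfolding inner F_def[of "l * c"] by (simp add: sum_distrib_left mult_ac)
  finally show ?thesis .
qed

lemma sum_kernel_corr:
  "(\<Sum>t\<in>{0..<int n}. kernel q t * corr c t) = (\<Sum>l\<in>{- int (2 * q)..int (2 * q)}. tent_conv q l * (F l * F (l * c)))"
proof -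
  have "(\<Sum>t\<in>{0..<int n}. kernel q t * corr c t)
      = (\<Sum>l\<in>{- int (2 * q)..int (2 * q)}. \<Sum>t\<in>{0..<int n}. tent_conv q l * (cs (l * t) * corr c t))"
    unfolding kernel_def sum_distrib_right by (subst sum.swap) (simp add: mult.assoc)
  then show ?thesis by (simp add: sum_distrib_left[symmetric] sum_cs_corr)
qed

text \<open>For values 1 and -1 one has |u - v| = 1 - u v, and then k -> c k is undone as a
  permutation of the residues, which removes c from the bound.\<close>

lemma corr_diff_le:
  assumes "coprime c (int n)"
  shows "\<bar>corr c 0 - corr c t\<bar> \<le> n - corr 1 t"
proof -
  have "\<bar>corr c 0 - corr c t\<bar> = \<bar>\<Sum>k\<in>{0..<int n}. f k * (f (c * k) - f (c * k - t))\<bar>"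
    by (simp add: corr_def sum_subtractf right_diff_distrib)
  also have "\<dots> \<le> (\<Sum>k\<in>{0..<int n}. \<bar>f k * (f (c * k) - f (c * k - t))\<bar>)" by (rule sum_abs)
  also have "\<dots> = (\<Sum>k\<in>{0..<int n}. 1 - f (c * k + 0) * f (c * k + 0 - t))"
  proof (rule sum.cong[OF refl])
    fix k show "\<bar>f k * (f (c * k) - f (c * k - t))\<bar> = 1 - f (c * k + 0) * f (c * k + 0 - t)"
      using f_values[of k] f_values[of "c * k"] f_values[of "c * k - t"] by auto
  qed
  also have "\<dots> = (\<Sum>k\<in>{0..<int n}. 1 - f k * f (k - t))"
  proof (rule sum_affine)
    show "1 - f (k + m * int n) * f (k + m * int n - t) = 1 - f k * f (k - t)" for k m
      using f_periodic[of "k - t" m] by (simp add: f_periodic algebra_simps)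
  qed fact
  finally show ?thesis by (simp add: corr_def sum_subtractf)
qed

text \<open>Averaging \<open>corr c t\<close> against the kernel gives the products F(l) F(l c), and
  averaging \<open>n - corr 1 t\<close> gives the squares F(l)^2. At l = 0 the two cancel, so the
  sum starts at 1.\<close>

lemma corr_smoothing:
  assumes "coprime c (int n)" "2 * int q - 1 \<le> int n"
  shows "n * tent_conv q 0 * (\<bar>corr c 0\<bar> - n)
    \<le> 2 * (\<Sum>l = 1..2 * q. tent_conv q (int l) * (\<bar>F (int l)\<bar> * \<bar>F (int l * c)\<bar> - (F (int l))\<^sup>2))"
proof -
  let ?Z = "{0..<int n}" and ?L = "{- int (2 * q)..int (2 * q)}"
  let ?T = "n * tent_conv q 0"
  have T: "(\<Sum>t\<in>?Z. kernel q t) = ?T" using assms by (simp add: sum_kernel)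
  have "?T * \<bar>corr c 0\<bar> = \<bar>(\<Sum>t\<in>?Z. kernel q t * corr c 0)\<bar>"
    unfolding sum_distrib_right[symmetric] T abs_mult using tent_conv_nonneg by simp
  also have "\<dots> = \<bar>(\<Sum>t\<in>?Z. kernel q t * corr c t) + (\<Sum>t\<in>?Z. kernel q t * (corr c 0 - corr c t))\<bar>"
    by (simp add: right_diff_distrib sum_subtractf)
  also have "\<dots> \<le> \<bar>\<Sum>t\<in>?Z. kernel q t * corr c t\<bar> + (\<Sum>t\<in>?Z. kernel q t * (n - corr 1 t))"
  proof -
    have "\<bar>\<Sum>t\<in>?Z. kernel q t * (corr c 0 - corr c t)\<bar> \<le> (\<Sum>t\<in>?Z. \<bar>kernel q t * (corr c 0 - corr c t)\<bar>)"
      by (rule sum_abs)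
    also have "\<dots> \<le> (\<Sum>t\<in>?Z. kernel q t * (n - corr 1 t))"
      unfolding abs_mult using corr_diff_le[OF assms(1)] kernel_nonneg
      by (intro sum_mono) (simp add: mult_left_mono)
    finally show ?thesis using abs_triangle_ineq by linarith
  qed
  also have "(\<Sum>t\<in>?Z. kernel q t * (n - corr 1 t)) = ?T * n - (\<Sum>l\<in>?L. tent_conv q l * (F l * F l))"
    using sum_kernel_corr[of q 1] T
    by (simp add: right_diff_distrib sum_subtractf sum_distrib_right[symmetric])
  also have "\<bar>\<Sum>t\<in>?Z. kernel q t * corr c t\<bar> \<le> (\<Sum>l\<in>?L. tent_conv q l * (\<bar>F l\<bar> * \<bar>F (l * c)\<bar>))"
  proof -
    have "\<bar>\<Sum>t\<in>?Z. kernel q t * corr c t\<bar> \<le> (\<Sum>l\<in>?L. \<bar>tent_conv q l * (F l * F (l * c))\<bar>)"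
      unfolding sum_kernel_corr by (rule sum_abs)
    then show ?thesis by (simp add: abs_mult tent_conv_nonneg)
  qed
  finally have "?T * (\<bar>corr c 0\<bar> - n) \<le> (\<Sum>l\<in>?L. tent_conv q l * (\<bar>F l\<bar> * \<bar>F (l * c)\<bar> - (F l)\<^sup>2))"
    by (simp add: right_diff_distrib sum_subtractf power2_eq_square)
  also have "\<dots> = 2 * (\<Sum>l = 1..2 * q. tent_conv q (int l) * (\<bar>F (int l)\<bar> * \<bar>F (int l * c)\<bar> - (F (int l))\<^sup>2))"
  proof -
    have "F 0 * F 0 = 1" using F_0 by (metis abs_mult_self_eq mult.right_neutral)
    then show ?thesis
      by (subst sum_symmetric_int) (simp_all add: F_0 power2_eq_square)
  qed
  finally show ?thesis .
qed

text \<open>The two sums are treated differently. In the products every weight is raised to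
  \<open>tent_conv q 0\<close>; of the squares only the odd l <= q are kept, where the weights are
  explicit and F(l)^2 is large.\<close>

lemma corr_bound:
  assumes "coprime c (int n)" and q: "q \<ge> 2" "2 * int q - 1 \<le> int n"
  shows "\<bar>corr c 0\<bar> \<le> n / q + 2 / n * (\<Sum>l = 1..2 * q - 2. \<bar>F (int l)\<bar> * \<bar>F (int l * c)\<bar>)"
proof -
  define A0 where "A0 = tent_conv q 0"
  define A1 where "A1 = real q * (2 * (real q)\<^sup>2 + 1) / 3"
  have A01: "A0 = A1" by (simp add: A0_def A1_def tent_conv_formula)
  have A0: "A0 > 0" unfolding A01 A1_def using q by (simp add: add_nonneg_pos)
  define p where "p = (q + 1) div 2"
  define X where "X = (\<Sum>l = 1..2 * q - 2. \<bar>F (int l)\<bar> * \<bar>F (int l * c)\<bar>)"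
  define W where "W = (\<Sum>j<p. (tent_conv q (2 * int j + 1) / A0) / (2 * real j + 1)\<^sup>2)"
  have "(\<Sum>l = 1..2 * q. tent_conv q (int l) * (\<bar>F (int l)\<bar> * \<bar>F (int l * c)\<bar>)) = (\<Sum>l = 1..2 * q - 2. tent_conv q (int l) * (\<bar>F (int l)\<bar> * \<bar>F (int l * c)\<bar>))"
    by (rule sum.mono_neutral_right) (auto intro!: tent_conv_eq_0)
  also have "\<dots> \<le> A0 * X"
    unfolding X_def sum_distrib_left A0_def
    by (intro sum_mono mult_right_mono tent_conv_le) auto
  finally have 1: "(\<Sum>l = 1..2 * q. tent_conv q (int l) * (\<bar>F (int l)\<bar> * \<bar>F (int l * c)\<bar>)) \<le> A0 * X" .
  have "A0 * (4 * (real n)\<^sup>2 / pi\<^sup>2 * W) = (\<Sum>j<p. tent_conv q (2 * int j + 1) * (4 * (real n)\<^sup>2 / (pi\<^sup>2 * (of_int (2 * int j + 1))\<^sup>2)))"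
    unfolding W_def sum_distrib_left using A0 by (intro sum.cong) (simp_all add: field_simps)
  also have "\<dots> \<le> (\<Sum>j<p. tent_conv q (2 * int j + 1) * (F (2 * int j + 1))\<^sup>2)"
  proof (intro sum_mono mult_left_mono tent_conv_nonneg F_squared_ge)
    fix j assume "j \<in> {..<p}"
    then have "2 * int j + 1 \<le> int q" by (auto simp: p_def)
    then show "2 * int j + 1 < int n" using q by linarith
  qed auto
  also have "\<dots> = (\<Sum>l\<in>(\<lambda>j. 2 * j + 1) ` {..<p}. tent_conv q (int l) * (F (int l))\<^sup>2)"
    by (subst sum.reindex) (auto simp: inj_on_def add.commute)
  also have "\<dots> \<le> (\<Sum>l = 1..2 * q. tent_conv q (int l) * (F (int l))\<^sup>2)"
    by (rule sum_mono2) (auto simp: p_def tent_conv_nonneg)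
  finally have 2: "A0 * (4 * (real n)\<^sup>2 / pi\<^sup>2 * W) \<le> (\<Sum>l = 1..2 * q. tent_conv q (int l) * (F (int l))\<^sup>2)" .
  have "n * A0 * (\<bar>corr c 0\<bar> - n) \<le> 2 * (A0 * X - A0 * (4 * (real n)\<^sup>2 / pi\<^sup>2 * W))"
    using corr_smoothing[OF assms(1) q(2)] 1 2 unfolding A0_def[symmetric]
    by (simp add: right_diff_distrib sum_subtractf)
  also have "\<dots> = n * A0 * (2 / n * X - n * (8 / pi\<^sup>2 * W))"
    using n_pos by (simp add: field_simps power2_eq_square)
  finally have "\<bar>corr c 0\<bar> - n \<le> 2 / n * X - n * (8 / pi\<^sup>2 * W)"
    using A0 n_pos by (subst (asm) mult_le_cancel_left_pos) auto
  moreover have "W = (\<Sum>j<p. ((A1 - real q * (2 * real j + 1)\<^sup>2 + ((2 * real j + 1) ^ 3 - (2 * real j + 1)) / 2) / A1)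
       / (2 * real j + 1)\<^sup>2)"
    unfolding W_def A01 A1_def
  proof (rule sum.cong[OF refl])
    fix j assume "j \<in> {..<p}"
    then have "2 * int j + 1 \<le> int q" by (auto simp: p_def)
    from tent_conv_formula[OF _ this]
    show "tent_conv q (2 * int j + 1) / (real q * (2 * (real q)\<^sup>2 + 1) / 3) / (2 * real j + 1)\<^sup>2
      = (real q * (2 * (real q)\<^sup>2 + 1) / 3 - real q * (2 * real j + 1)\<^sup>2 + ((2 * real j + 1) ^ 3 - (2 * real j + 1)) / 2) /
         (real q * (2 * (real q)\<^sup>2 + 1) / 3) / (2 * real j + 1)\<^sup>2" by simp
  qed
  then have "1 - 8 / pi\<^sup>2 * W \<le> 1 / q"
    using jackson_weighted_sum_ge[OF q(1)] by (simp only: A1_def p_def)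
  then have "n * (1 - 8 / pi\<^sup>2 * W) \<le> n * (1 / q)" by (intro mult_left_mono) auto
  ultimately show ?thesis by (simp add: X_def right_diff_distrib)
qed


section \<open>Estimates for the correlation\<close>

lemma corr_window_sum:
  assumes "coprime c (int n)"
  shows "\<bar>corr c 0 - 2 * (\<Sum>k\<in>{- r..r}. f (c * k))\<bar> = 1"
proof -
  have "corr c 0 = 2 * (\<Sum>k\<in>{- r..r}. f (c * k)) - (\<Sum>k\<in>{0..<int n}. f (c * k))"
    using sum_f_mult[of "\<lambda>k. f (c * k)"] f_periodic' by (simp add: corr_def)
  moreover have "(\<Sum>k\<in>{0..<int n}. f (c * k)) = F 0"
    using sum_affine[of f c 0] assms f_periodic by (simp add: F_def cs_def)
  ultimately show ?thesis using F_0 by simp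
qed

text \<open>The values f (d k) sample the square wave at spacing \<delta> = d/n, so \<delta> times
  the window sum is a Riemann sum for the increment of the triangle wave over nearly [-d/4, d/4].
  Only steps across a jump err, and there are O(d) jumps.\<close>

lemma corr_small_multiplier:
  assumes d: "d > 0" "coprime d (int n)"
  shows "\<bar>\<bar>corr d 0\<bar> - n / d * (if odd d then 1 else 0)\<bar> \<le> 14 * d"
proof -
  define \<delta> where "\<delta> = real_of_int d / n"
  have \<delta>: "\<delta> > 0" using d n_pos by (simp add: \<delta>_def)
  \<comment> \<open>The cells are centred at the sampling points, which makes the outer endpoints -E
    and E symmetric.\<close>
  define x where "x k = \<delta> * (of_int k - 1/2)" for k :: int
  define E where "E = \<delta> * (of_int r + 1/2)"
  define W where "W = (\<Sum>k\<in>{- r..r}. f (d * k))"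
  let ?tw = triangle_wave
  have ends: "x (r + 1) = E" "x (- r) = - E" by (simp_all add: x_def E_def algebra_simps)
  have f: "f (d * k) = sign_pm (cos (2 * pi * (\<delta> * of_int k)))" for k
    by (simp add: f_def cs_def \<delta>_def mult_ac)
  have step: "\<bar>?tw (x (k + 1)) - ?tw (x k) - \<delta> * f (d * k)\<bar>
      \<le> 2 * \<delta> * (of_int (half_period (x (k + 1))) - of_int (half_period (x k)))" for k
  proof -
    have "cos (2 * pi * (\<delta> * of_int k)) = cs (d * k)" by (simp add: cs_def \<delta>_def mult_ac)
    then have "cos (2 * pi * (\<delta> * of_int k)) \<noteq> 0" using cs_nonzero by simp
    moreover have "x k \<le> \<delta> * of_int k" "\<delta> * of_int k \<le> x (k + 1)" "x (k + 1) - x k = \<delta>"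
      using \<delta> by (simp_all add: x_def algebra_simps)
    ultimately show ?thesis using triangle_wave_step[of "x k" "\<delta> * of_int k" "x (k + 1)"] f by simp
  qed
  have "?tw E - ?tw (- E) - \<delta> * W = (\<Sum>k\<in>{- r..r}. ?tw (x (k + 1)) - ?tw (x k) - \<delta> * f (d * k))"
    using sum_telescope_int[of "- r" r "\<lambda>k. ?tw (x (k + 1)) - ?tw (x k)" "\<lambda>k. ?tw (x k)"] r_bounds(3)
    by (simp add: sum_subtractf sum_distrib_left W_def ends)
  also have "\<bar>\<dots>\<bar> \<le> (\<Sum>k\<in>{- r..r}. 2 * \<delta> * (of_int (half_period (x (k + 1))) - of_int (half_period (x k))))"
    by (rule order_trans[OF sum_abs]) (intro sum_mono step)
  also have "\<dots> = 2 * \<delta> * (of_int (half_period E) - of_int (half_period (- E)))"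
    using sum_telescope_int[of "- r" r _ "\<lambda>k. 2 * \<delta> * of_int (half_period (x k))"] r_bounds(3)
    by (simp add: ends right_diff_distrib)
  \<comment> \<open>The number of jumps between -E and E is at most 4 E + 1 <= 2 d + 1 <= 3
    d.\<close>
  also have "\<dots> \<le> 2 * \<delta> * (3 * real_of_int d)"
  proof (rule mult_left_mono)
    have "4 * E = \<delta> * of_int (4 * r + 2)" by (simp add: E_def algebra_simps)
    also have "\<dots> \<le> \<delta> * of_int (int n + 1)" using \<delta> r_bounds by (intro mult_left_mono) auto
    also have "\<dots> = d + d / n" using n_pos by (simp add: \<delta>_def field_simps)
    also have "\<dots> \<le> 2 * d" using n_gt_1 d by (simp add: field_simps)
    finally have "4 * E \<le> 2 * d" .
    moreover have "of_int (half_period E) - of_int (half_period (- E)) \<le> 4 * E + 1"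
      unfolding half_period_def by linarith
    moreover have "1 \<le> real_of_int d" using d by linarith
    ultimately show "of_int (half_period E) - of_int (half_period (- E)) \<le> 3 * real_of_int d" by linarith
  qed (use \<delta> in simp)
  finally have 1: "\<bar>?tw E - ?tw (- E) - \<delta> * W\<bar> \<le> 6 * d * \<delta>" by (simp add: mult_ac)
  have close: "\<bar>E - d / 4\<bar> \<le> \<delta> / 4"
  proof -
    have "\<bar>4 * r + 2 - int n\<bar> \<le> 1" using r_bounds odd_n by presburger
    then have "\<bar>real_of_int (4 * r + 2 - int n)\<bar> \<le> 1" by linarith
    then have "(\<delta> / 4) * \<bar>real_of_int (4 * r + 2 - int n)\<bar> \<le> (\<delta> / 4) * 1"
      using \<delta> by (intro mult_left_mono) auto
    moreover have "E - d / 4 = (\<delta> / 4) * of_int (4 * r + 2 - int n)"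
      using n_pos by (simp add: E_def \<delta>_def field_simps)
    then have "\<bar>E - d / 4\<bar> = (\<delta> / 4) * \<bar>real_of_int (4 * r + 2 - int n)\<bar>"
      using \<delta> by (simp only: abs_mult)
    ultimately show ?thesis by linarith
  qed
  have 2: "\<bar>?tw E - ?tw (d / 4)\<bar> \<le> \<delta> / 4" "\<bar>?tw (- E) - ?tw (- (d / 4))\<bar> \<le> \<delta> / 4"
    using triangle_wave_lipschitz[of E "d / 4"] triangle_wave_lipschitz[of "- E" "- (d / 4)"] close
    by linarith+
  define \<tau> where "\<tau> = ?tw (d / 4) - ?tw (- (d / 4))"
  have "\<bar>\<delta> * W - \<tau>\<bar> \<le> \<delta> * (6 * d + 1/2)" 
  proof -
    have "\<delta> * (6 * d + 1/2) = 6 * d * \<delta> + \<delta> / 2" by (simp add: algebra_simps)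
    then show ?thesis using 1 2 unfolding \<tau>_def by linarith
  qed
  then have "\<bar>\<delta> * (W - \<tau> / \<delta>)\<bar> \<le> \<delta> * (6 * d + 1/2)" using \<delta> by (simp add: right_diff_distrib)
  then have "\<bar>W - \<tau> / \<delta>\<bar> \<le> 6 * d + 1/2" using \<delta> by (simp add: abs_mult)
  moreover have "\<bar>corr d 0 - 2 * W\<bar> = 1" using corr_window_sum[OF d(2)] by (simp add: W_def)
  \<comment> \<open>2 (6 d + 1/2) from the Riemann sum and 1 from the window give 12 d + 2, which is
    at most 14 d.\<close>
  ultimately have "\<bar>corr d 0 - 2 * (\<tau> / \<delta>)\<bar> \<le> 12 * d + 2" by linarith
  then have "\<bar>\<bar>corr d 0\<bar> - \<bar>2 * (\<tau> / \<delta>)\<bar>\<bar> \<le> 12 * d + 2" using abs_triangle_ineq3 order_trans by blast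
  moreover have "\<bar>2 * (\<tau> / \<delta>)\<bar> = n / d * (if odd d then 1 else 0)"
  proof -
    have "\<bar>2 * (\<tau> / \<delta>)\<bar> = 2 * \<bar>\<tau>\<bar> / \<delta>" using \<delta> by (simp add: abs_mult)
    also have "\<bar>\<tau>\<bar> = (if odd d then 1/2 else 0)" unfolding \<tau>_def by (rule triangle_wave_quarter)
    finally show ?thesis by (simp add: \<delta>_def)
  qed
  moreover have "1 \<le> real_of_int d" using d by linarith
  ultimately show ?thesis by linarith
qed

text \<open>The coefficient bound 2 n / l is used for l up to n/2 only, so m is first cut to
  \<open>m0\<close>. If the cut is effective, then n <= 2 \<open>m0\<close> + 2 and the term n/q is
  at most 4. The other half of the constant 8 pays for the even harmonic \<open>m0\<close> +
  1.\<close>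

lemma corr_le_harmonics:
  assumes "prime n" and c: "\<not> int n dvd c" and m: "1 \<le> m" "m < n"
  shows "\<bar>corr c 0\<bar> \<le> (2 / (real m + 2) +
     (\<Sum>l = 1..m. 12 / (real l * of_int (toroidal_norm n ((int l * c) mod int n))))) * n + 8"
proof -
  define D where "D l = toroidal_norm n ((int l * c) mod int n)" for l
  define m0 where "m0 = min m ((n - 1) div 2)"
  define q where "q = (m0 + 3) div 2"
  have n3: "n \<ge> 3" using n_gt_1 odd_n by (cases "n = 2") auto
  have m0: "1 \<le> m0" "m0 \<le> m" "2 * m0 + 1 \<le> n" using n3 m by (auto simp: m0_def)
  \<comment> \<open>The kernel degree 2 q - 2 is \<open>m0\<close> for even \<open>m0\<close> and
    \<open>m0\<close> + 1 for odd \<open>m0\<close>; in both cases n/q <= 2 n / (\<open>m0\<close> +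
    2).\<close>
  have q: "q \<ge> 2" "2 * q \<ge> m0 + 2" "2 * int q - 1 \<le> int n" "2 * q - 2 = m0 \<or> 2 * q - 2 = m0 + 1"
    using m0 n3 by (auto simp: q_def)
  have pn: "prime (int n)" using assms by simp
  have cop: "coprime c (int n)" using prime_imp_coprime[OF pn c] by (simp add: coprime_commute)
  have res: "0 < (int l * c) mod int n \<and> (int l * c) mod int n < int n" if "1 \<le> l" "l < n" for l
  proof -
    have "\<not> int n dvd int l" using that by (auto dest: zdvd_imp_le)
    then have "\<not> int n dvd int l * c" using pn c by (simp add: prime_dvd_mult_iff)
    then have "(int l * c) mod int n \<noteq> 0" using mod_0_imp_dvd by blast
    moreover have "0 \<le> (int l * c) mod int n" "(int l * c) mod int n < int n" using n_pos by simp_all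
    ultimately show ?thesis by linarith
  qed
  have D: "D l > 0" if "1 \<le> l" "l < n" for l
    using res[OF that] by (simp add: D_def toroidal_norm_def)
  have FD: "\<bar>F (int l * c)\<bar> \<le> 2 * n / of_int (D l)" if "1 \<le> l" "l < n" for l
  proof -
    have "F (int l * c) = F ((int l * c) mod int n)"
      using F_periodic[of "(int l * c) mod int n" "(int l * c) div int n"] by simp
    then show ?thesis using F_abs_le_norm[of "(int l * c) mod int n"] res[OF that]
      by (simp add: D_def toroidal_norm_def)
  qed
  define \<Sigma> where "\<Sigma> = (\<Sum>l = 1..m0. 2 * n / real l * (2 * n / of_int (D l)))"
  have main: "(\<Sum>l = 1..m0. \<bar>F (int l)\<bar> * \<bar>F (int l * c)\<bar>) \<le> \<Sigma>"
    unfolding \<Sigma>_def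
  proof (rule sum_mono)
    fix l assume l: "l \<in> {1..m0}"
    have "\<bar>F (int l)\<bar> \<le> 2 * n / real l" using F_abs_le_half[of "int l"] l m0 by auto
    then show "\<bar>F (int l)\<bar> * \<bar>F (int l * c)\<bar> \<le> 2 * n / real l * (2 * n / of_int (D l))"
      using FD[of l] l m0 by (intro mult_mono) auto
  qed
  have "(\<Sum>l = 1..2 * q - 2. \<bar>F (int l)\<bar> * \<bar>F (int l * c)\<bar>) \<le> \<Sigma> + 2 * n"
    using q(4)
  proof
    assume "2 * q - 2 = m0"
    then show ?thesis using main by simp
  next
    assume eq: "2 * q - 2 = m0 + 1"
    have "even (2 * q - 2)" by simp
    then have "even (m0 + 1)" by (simp only: eq)
    then have "\<bar>F (int (m0 + 1))\<bar> \<le> 2" using m0 n3 by (intro F_abs_le_even) auto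
    then have "\<bar>F (int (m0 + 1))\<bar> * \<bar>F (int (m0 + 1) * c)\<bar> \<le> 2 * real n"
      using F_abs_le[of "int (m0 + 1) * c"] by (intro mult_mono) auto
    then show ?thesis using main unfolding eq by simp
  qed
  then have "2 / n * (\<Sum>l = 1..2 * q - 2. \<bar>F (int l)\<bar> * \<bar>F (int l * c)\<bar>) \<le> 2 / n * (\<Sigma> + 2 * n)"
    by (intro mult_left_mono) auto
  also have "\<dots> = 2 / n * \<Sigma> + 4" using n_pos by (simp add: field_simps)
  \<comment> \<open>The factor 2/n times the two coefficient bounds 2 n / l and 2 n / D l produces
    8, within the stated 12.\<close>
  also have "2 / n * \<Sigma> = (\<Sum>l = 1..m0. 8 / (real l * of_int (D l))) * n"
    unfolding \<Sigma>_def sum_distrib_left sum_distrib_right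
    using n_pos by (intro sum.cong) (simp_all add: field_simps)
  also have "(\<Sum>l = 1..m0. 8 / (real l * of_int (D l))) \<le> (\<Sum>l = 1..m. 12 / (real l * of_int (D l)))"
  proof -
    have "(\<Sum>l = 1..m0. 8 / (real l * of_int (D l))) \<le> (\<Sum>l = 1..m0. 12 / (real l * of_int (D l)))"
      using D m0 by (intro sum_mono divide_right_mono mult_nonneg_nonneg) (auto simp: order_less_imp_le)
    also have "\<dots> \<le> (\<Sum>l = 1..m. 12 / (real l * of_int (D l)))"
      using D m0 m by (intro sum_mono2 divide_nonneg_nonneg mult_nonneg_nonneg) (auto simp: order_less_imp_le)
    finally show ?thesis .
  qed
  finally have "2 / n * (\<Sum>l = 1..2 * q - 2. \<bar>F (int l)\<bar> * \<bar>F (int l * c)\<bar>)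
      \<le> (\<Sum>l = 1..m. 12 / (real l * of_int (D l))) * n + 4" using n_pos by simp
  moreover have "n / q \<le> 2 / (real m + 2) * n + 4"
  proof -
    have "real n / q \<le> n / ((m0 + 2) / 2)" using q by (intro divide_left_mono) auto
    also have "\<dots> \<le> 2 / (real m + 2) * n + 4"
    proof (cases "m0 = m")
      case False
      then have "n \<le> 2 * m0 + 2" unfolding m0_def by linarith
      then have "n / ((m0 + 2) / 2) \<le> (4::real)" by (simp add: divide_simps)
      then show ?thesis by (rule order_trans) simp
    qed (simp add: mult.commute add.commute)
    finally show ?thesis .
  qed
  ultimately have "\<bar>corr c 0\<bar> \<le> (2 / (real m + 2) * n + 4) + ((\<Sum>l = 1..m. 12 / (real l * of_int (D l))) * n + 4)"
    using corr_bound[OF cop q(1) q(3)] by linarith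
  then show ?thesis by (simp add: D_def distrib_right)
qed

section \<open>The measure and its Fourier series\<close>

text \<open>The measure puts mass \<open>2 / n\<close> on each point \<open>c k / n\<close> with \<open>\<bar>k\<bar> < n / 4\<close>; its total mass
  \<open>1 \<plusminus> 1 / n\<close> is close to \<open>1\<close>.\<close>

definition progression_measure :: "int \<Rightarrow> torus measure" where
  "progression_measure c = distr (point_measure {- r..r} (\<lambda>_. ennreal (2 / n))) borel
     (\<lambda>k. abs_torus (of_int (c * k) / n))"

lemma progression_measurable:
  "(\<lambda>k. abs_torus (of_int (c * k) / n)) \<in> measurable (point_measure {- r..r} w) borel"
  by (simp add: measurable_point_measure_eq1)

lemma finite_progression_measure: "finite_measure (progression_measure c)"
  unfolding progression_measure_def
  by (intro finite_measure.finite_measure_distr progression_measurable finite_measureI)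
     (simp add: emeasure_point_measure_finite space_point_measure ennreal_mult_eq_top_iff)

lemma Re_fourier_progression_measure:
  "Re (fourier_coeff (progression_measure c) l) = (\<Sum>k\<in>{- r..r}. 2 / n * cs (l * (c * k)))"
proof -
  have "torus_char l \<in> borel_measurable borel"
    by (rule borel_measurable_continuous_onI[OF continuous_on_torus_char])
  then have "fourier_coeff (progression_measure c) l
      = (\<Sum>k\<in>{- r..r}. (2 / n) *\<^sub>R torus_char l (abs_torus (of_int (c * k) / n)))"
    unfolding fourier_coeff_def progression_measure_def
    by (subst integral_distr[OF progression_measurable])
       (simp_all add: lebesgue_integral_point_measure_finite)
  moreover have "Re (torus_char l (abs_torus (of_int (c * k) / n))) = cs (l * (c * k))" for k
    by (simp add: torus_char.abs_eq Re_exp cs_def mult_ac)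
  ultimately show ?thesis by simp
qed

text \<open>The square-wave series is summed over the finitely many points c k / n. None of them is
  a jump since n is odd, so each series converges to the sign there; only a finite sum is exchanged
  with these conditionally convergent series.\<close>

lemma fourier_progression_sums:
  "(\<lambda>l::nat. if odd l then (-1) ^ ((l - 1) div 2) / real l * Re (fourier_coeff (progression_measure c) (int l)) else 0)
     sums (pi / (2 * n) * (\<Sum>k\<in>{- r..r}. f (c * k)))"
proof -
  let ?g = "\<lambda>l::nat. if odd l then (-1) ^ ((l - 1) div 2) / real l * Re (fourier_coeff (progression_measure c) (int l)) else 0"
  have "(\<lambda>j. \<Sum>k\<in>{- r..r}. 2 / n * ((-1) ^ j / (2 * real j + 1) * cos (2 * pi * (2 * real j + 1) * (of_int (c * k) / n))))
      sums (\<Sum>k\<in>{- r..r}. 2 / n * (pi / 4 * sign_pm (cos (2 * pi * (of_int (c * k) / n)))))"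
  proof (intro sums_sum sums_mult square_wave_sums)
    show "cos (2 * pi * (of_int (c * k) / n)) \<noteq> 0" for k
      using cs_nonzero[of "c * k"] by (simp add: cs_def)
  qed
  moreover have "(\<Sum>k\<in>{- r..r}. 2 / n * (pi / 4 * sign_pm (cos (2 * pi * (of_int (c * k) / n)))))
      = pi / (2 * n) * (\<Sum>k\<in>{- r..r}. f (c * k))"
    unfolding sum_distrib_left by (intro sum.cong) (simp_all add: f_def cs_def)
  moreover have "(\<Sum>k\<in>{- r..r}. 2 / n * ((-1) ^ j / (2 * real j + 1) * cos (2 * pi * (2 * real j + 1) * (of_int (c * k) / n))))
      = ?g (2 * j + 1)" for j :: nat
  proof -
    have "cos (2 * pi * (2 * real j + 1) * (of_int (c * k) / n)) = cs (int (2 * j + 1) * (c * k))" for k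
      by (simp add: cs_def algebra_simps)
    then show ?thesis
      by (simp add: Re_fourier_progression_measure sum_distrib_left add.commute mult_ac)
  qed
  ultimately have "(\<lambda>j. ?g (2 * j + 1)) sums (pi / (2 * n) * (\<Sum>k\<in>{- r..r}. f (c * k)))" by simp
  then show ?thesis
  proof (subst (asm) sums_mono_reindex)
    show "strict_mono (\<lambda>j::nat. 2 * j + 1)" by (simp add: strict_mono_def)
    show "?g l = 0" if "l \<notin> range (\<lambda>j::nat. 2 * j + 1)" for l
      using that by (auto elim!: oddE)
  qed
qed

end

section \<open>Passage to prime fields\<close>

lemma field_quot_prime:
  assumes "prime n" and a: "a \<in> carrier (residue_ring (int n)) - {\<zero>\<^bsub>residue_ring (int n)\<^esub>}"
    and b: "b \<in> carrier (residue_ring (int n)) - {\<zero>\<^bsub>residue_ring (int n)\<^esub>}"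
  shows "0 < field_quot n a b" "field_quot n a b < int n" "(a * field_quot n a b) mod int n = b"
    "0 < a" "a < int n" "0 < b" "b < int n"
proof -
  interpret residues_prime n "residue_ring (int n)"
    by (simp_all add: residues_prime_def assms)
  let ?R = "residue_ring (int n)"
  have n: "int n > 1" using assms(1) prime_gt_1_nat by simp
  have ab: "0 < a" "a < int n" "0 < b" "b < int n"
    using a b unfolding res_carrier_eq res_zero_eq by auto
  then show "0 < a" "a < int n" "0 < b" "b < int n" .
  have U: "a \<in> Units ?R" using ab by (simp add: res_prime_units_eq)
  define c where "c = field_quot n a b"
  have cc: "c \<in> carrier ?R" unfolding c_def field_quot_def using U b by (intro m_closed Units_inv_closed) auto
  have "a \<otimes>\<^bsub>?R\<^esub> c = (a \<otimes>\<^bsub>?R\<^esub> inv\<^bsub>?R\<^esub> a) \<otimes>\<^bsub>?R\<^esub> b"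
    unfolding c_def field_quot_def using U a b by (intro m_assoc[symmetric] Units_inv_closed) auto
  also have "\<dots> = b" using U b by (simp add: Units_r_inv)
  finally show ac: "(a * field_quot n a b) mod int n = b" by (simp add: res_mult_eq c_def)
  have "c \<noteq> 0" using ac ab by (auto simp: c_def)
  then show "0 < field_quot n a b" "field_quot n a b < int n"
    using cc unfolding res_carrier_eq c_def by auto
qed

lemma residue_ring_add_pow:
  assumes "n > 1" "0 \<le> x" "x < int n"
  shows "[l] \<cdot>\<^bsub>residue_ring (int n)\<^esub> x = (int l * x) mod int n"
proof -
  interpret residues "int n" "residue_ring (int n)" using assms by (simp_all add: residues_def)
  have x: "x \<in> carrier (residue_ring (int n))" using assms by (simp add: res_carrier_eq)
  show ?thesis
  proof (induction l)
    case 0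
    then show ?case by (simp add: res_zero_eq)
  next
    case (Suc l)
    then show ?case by (simp add: add.nat_pow_Suc res_add_eq mod_add_right_eq algebra_simps)
  qed
qed

lemma sign_cos_sum_le: "0 \<le> sign_cos_sum n a b" "sign_cos_sum n a b \<le> n"
proof -
  show "0 \<le> sign_cos_sum n a b" by (simp add: sign_cos_sum_def)
  have "sign_cos_sum n a b \<le> (\<Sum>k = 1..n. 1)"
    unfolding sign_cos_sum_def by (intro order_trans[OF sum_abs] sum_mono) (simp add: sign_pm_def)
  then show "sign_cos_sum n a b \<le> n" by simp
qed

lemma (in odd_modulus) sign_cos_sum_eq_corr:
  assumes "coprime a (int n)" "(a * c) mod int n = b mod int n"
  shows "sign_cos_sum n a b = \<bar>corr c 0\<bar>"
proof -
  let ?G = "\<lambda>k. f k * f (c * k)"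
  have "(\<Sum>k = 1..n. sign_pm (cos (2 * pi / real n * of_int a * real k)) *
                  sign_pm (cos (2 * pi / real n * of_int b * real k)))
      = (\<Sum>k\<in>{1..<1 + int n}. f (a * k) * f (b * k))"
    by (rule sum.reindex_bij_witness[of _ nat int]) (auto simp: f_def cs_def mult_ac)
  also have "\<dots> = (\<Sum>k\<in>{0..<int n}. f (a * k) * f (b * k))"
    by (rule sum_window) (simp add: f_periodic')
  also have "\<dots> = (\<Sum>k\<in>{0..<int n}. ?G (a * k + 0))"
  proof (rule sum.cong[OF refl])
    fix k
    have "int n dvd a * c - b" using assms(2) by (simp add: mod_eq_dvd_iff)
    then obtain e where "a * c - b = int n * e" by (auto elim: dvdE)
    then have "a * c * k = (b + int n * e) * k" by simp
    then have "c * (a * k) = b * k + (e * k) * int n" by (simp add: algebra_simps)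
    then show "f (a * k) * f (b * k) = ?G (a * k + 0)" using f_periodic[of "b * k" "e * k"] by simp
  qed
  also have "\<dots> = (\<Sum>k\<in>{0..<int n}. ?G k)"
    by (rule sum_affine) (simp_all add: f_periodic f_periodic' assms)
  finally show ?thesis by (simp add: sign_cos_sum_def corr_def)
qed

lemma odd_modulus_prime: "n \<noteq> 2 \<Longrightarrow> prime n \<Longrightarrow> odd_modulus n"
  using prime_gt_1_nat[of n] prime_odd_nat[of n] by unfold_locales auto

lemma prime_residue_coprime:
  assumes "prime n" "0 < x" "x < int n"
  shows "coprime x (int n)"
proof -
  have "\<not> int n dvd x" using assms by (auto dest: zdvd_imp_le)
  then show ?thesis using assms prime_imp_coprime[of "int n" x] by (simp add: coprime_commute)
qed

theorem theorem1:
  shows "(\<exists>C::real. \<forall>(n::nat) (a::int) (b::int).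
            prime n \<longrightarrow>
            a \<in> carrier (residue_ring (int n)) - {\<zero>\<^bsub>residue_ring (int n)\<^esub>} \<longrightarrow>
            b \<in> carrier (residue_ring (int n)) - {\<zero>\<^bsub>residue_ring (int n)\<^esub>} \<longrightarrow>
            (let d = toroidal_norm n (field_quot n a b) in
              \<bar>sign_cos_sum n a b - real n / of_int d * (if odd d then 1 else 0)\<bar>
                \<le> C * of_int d))
       \<and> (\<exists>C::real. \<forall>(n::nat) (a::int) (b::int) (m::nat).
            prime n \<longrightarrow>
            a \<in> carrier (residue_ring (int n)) - {\<zero>\<^bsub>residue_ring (int n)\<^esub>} \<longrightarrow>
            b \<in> carrier (residue_ring (int n)) - {\<zero>\<^bsub>residue_ring (int n)\<^esub>} \<longrightarrow>
            1 \<le> m \<longrightarrow> m < n \<longrightarrow>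
            sign_cos_sum n a b \<le>
              (2 / (real m + 2) +
               (\<Sum>l = 1..m. 12 / (real l *
                  of_int (toroidal_norm n ([l] \<cdot>\<^bsub>residue_ring (int n)\<^esub> field_quot n a b)))))
              * real n + C)
       \<and> (\<exists>C::real. \<forall>(n::nat) (a::int) (b::int).
            prime n \<longrightarrow>
            a \<in> carrier (residue_ring (int n)) - {\<zero>\<^bsub>residue_ring (int n)\<^esub>} \<longrightarrow>
            b \<in> carrier (residue_ring (int n)) - {\<zero>\<^bsub>residue_ring (int n)\<^esub>} \<longrightarrow>
            (\<exists>(M :: torus measure) (s::real).
              finite_measure M \<and> sets M = sets borel \<and>
              (\<lambda>l::nat. if odd l
                 then (-1) ^ ((l - 1) div 2) / real l * Re (fourier_coeff M (int l))
                 else 0) sums s \<and>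
              \<bar>sign_cos_sum n a b - \<bar>4 * real n / pi * s\<bar>\<bar> \<le> C))"
proof (intro conjI)
  show "\<exists>C::real. \<forall>(n::nat) (a::int) (b::int).
            prime n \<longrightarrow>
            a \<in> carrier (residue_ring (int n)) - {\<zero>\<^bsub>residue_ring (int n)\<^esub>} \<longrightarrow>
            b \<in> carrier (residue_ring (int n)) - {\<zero>\<^bsub>residue_ring (int n)\<^esub>} \<longrightarrow>
            (let d = toroidal_norm n (field_quot n a b) in
              \<bar>sign_cos_sum n a b - real n / of_int d * (if odd d then 1 else 0)\<bar>
                \<le> C * of_int d)"
  proof (rule exI[of _ 14], intro allI impI)
    fix n :: nat and a b :: int
    assume n: "prime n" and a: "a \<in> carrier (residue_ring (int n)) - {\<zero>\<^bsub>residue_ring (int n)\<^esub>}"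
      and b: "b \<in> carrier (residue_ring (int n)) - {\<zero>\<^bsub>residue_ring (int n)\<^esub>}"
    note q = field_quot_prime[OF n a b]
    define c where "c = field_quot n a b"
    define d where "d = toroidal_norm n c"
    have d: "d > 0" "d = c \<or> d = int n - c" "2 * d \<le> int n"
      using q by (auto simp: d_def toroidal_norm_def c_def min_def)
    have "\<bar>sign_cos_sum n a b - real n / of_int d * (if odd d then 1 else 0)\<bar> \<le> 14 * of_int d"
    proof (cases "n = 2")
      case True
      \<comment> \<open>Here the main term is 2 and the sum lies between 0 and 2.\<close>
      then have "d = 1" using d by linarith
      then show ?thesis using sign_cos_sum_le[of n a b] True by simp
    next
      case False
      interpret odd_modulus n using False n by (rule odd_modulus_prime)
      \<comment> \<open>f is even and n-periodic, so c and n - c have the same correlation.\<close>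
      have "corr d 0 = corr c 0" using d(2)
      proof
        assume "d = int n - c"
        then have "d * k = - (c * k) + k * int n" for k
          by (simp only: left_diff_distrib) (simp add: mult.commute)
        then have "f (d * k) = f (c * k)" for k by (simp only: f_periodic f_minus)
        then show ?thesis by (simp add: corr_def)
      qed simp
      moreover have "coprime d (int n)" using d q n prime_residue_coprime[OF n, of d] by simp
      ultimately show ?thesis
        using corr_small_multiplier[of d] d sign_cos_sum_eq_corr[of a c b] q prime_residue_coprime[OF n, of a]
        by (simp add: c_def)
    qed
    then show "let d = toroidal_norm n (field_quot n a b) in
       \<bar>sign_cos_sum n a b - real n / of_int d * (if odd d then 1 else 0)\<bar> \<le> 14 * of_int d"
      by (simp add: Let_def d_def c_def)
  qed
next
  show "\<exists>C::real. \<forall>(n::nat) (a::int) (b::int) (m::nat).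
            prime n \<longrightarrow>
            a \<in> carrier (residue_ring (int n)) - {\<zero>\<^bsub>residue_ring (int n)\<^esub>} \<longrightarrow>
            b \<in> carrier (residue_ring (int n)) - {\<zero>\<^bsub>residue_ring (int n)\<^esub>} \<longrightarrow>
            1 \<le> m \<longrightarrow> m < n \<longrightarrow>
            sign_cos_sum n a b \<le>
              (2 / (real m + 2) +
               (\<Sum>l = 1..m. 12 / (real l *
                  of_int (toroidal_norm n ([l] \<cdot>\<^bsub>residue_ring (int n)\<^esub> field_quot n a b)))))
              * real n + C"
  proof (rule exI[of _ 8], intro allI impI)
    fix n m :: nat and a b :: int
    assume n: "prime n" and a: "a \<in> carrier (residue_ring (int n)) - {\<zero>\<^bsub>residue_ring (int n)\<^esub>}"
      and b: "b \<in> carrier (residue_ring (int n)) - {\<zero>\<^bsub>residue_ring (int n)\<^esub>}"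
      and m: "1 \<le> m" "m < n"
    note q = field_quot_prime[OF n a b]
    define c where "c = field_quot n a b"
    have "sign_cos_sum n a b \<le> (2 / (real m + 2) +
        (\<Sum>l = 1..m. 12 / (real l * of_int (toroidal_norm n ((int l * c) mod int n))))) * real n + 8"
      (is "_ \<le> ?R")
    proof (cases "n = 2")
      case True
      \<comment> \<open>For n = 2 the sum is at most 2, so a nonnegative main term is
        enough.\<close>
      have "toroidal_norm n ((int l * c) mod int n) \<ge> 0" for l
        using True pos_mod_bound[of "int n" "int l * c"] by (auto simp: toroidal_norm_def)
      then have "0 \<le> (2 / (real m + 2) +
        (\<Sum>l = 1..m. 12 / (real l * of_int (toroidal_norm n ((int l * c) mod int n))))) * real n"
        by (intro mult_nonneg_nonneg add_nonneg_nonneg sum_nonneg divide_nonneg_nonneg) auto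
      then show ?thesis using sign_cos_sum_le(2)[of n a b] True by linarith
    next
      case False
      interpret odd_modulus n using False n by (rule odd_modulus_prime)
      have "\<not> int n dvd c" using q by (auto simp: c_def dest: zdvd_imp_le)
      then show ?thesis
        using corr_le_harmonics[OF n _ m, of c] sign_cos_sum_eq_corr[of a c b] q prime_residue_coprime[OF n, of a]
        by (simp add: c_def)
    qed
    then show "sign_cos_sum n a b \<le> (2 / (real m + 2) + (\<Sum>l = 1..m. 12 / (real l *
        of_int (toroidal_norm n ([l] \<cdot>\<^bsub>residue_ring (int n)\<^esub> field_quot n a b))))) * real n + 8"
      using q prime_gt_1_nat[OF n] by (simp add: residue_ring_add_pow c_def)
  qed
next
  show "\<exists>C::real. \<forall>(n::nat) (a::int) (b::int).
            prime n \<longrightarrow>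
            a \<in> carrier (residue_ring (int n)) - {\<zero>\<^bsub>residue_ring (int n)\<^esub>} \<longrightarrow>
            b \<in> carrier (residue_ring (int n)) - {\<zero>\<^bsub>residue_ring (int n)\<^esub>} \<longrightarrow>
            (\<exists>(M :: torus measure) (s::real).
              finite_measure M \<and> sets M = sets borel \<and>
              (\<lambda>l::nat. if odd l
                 then (-1) ^ ((l - 1) div 2) / real l * Re (fourier_coeff M (int l))
                 else 0) sums s \<and>
              \<bar>sign_cos_sum n a b - \<bar>4 * real n / pi * s\<bar>\<bar> \<le> C)"
  proof (rule exI[of _ 2], intro allI impI)
    fix n :: nat and a b :: int
    assume n: "prime n" and a: "a \<in> carrier (residue_ring (int n)) - {\<zero>\<^bsub>residue_ring (int n)\<^esub>}"
      and b: "b \<in> carrier (residue_ring (int n)) - {\<zero>\<^bsub>residue_ring (int n)\<^esub>}"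
    note q = field_quot_prime[OF n a b]
    define c where "c = field_quot n a b"
    show "\<exists>(M :: torus measure) (s::real).
              finite_measure M \<and> sets M = sets borel \<and>
              (\<lambda>l::nat. if odd l
                 then (-1) ^ ((l - 1) div 2) / real l * Re (fourier_coeff M (int l))
                 else 0) sums s \<and>
              \<bar>sign_cos_sum n a b - \<bar>4 * real n / pi * s\<bar>\<bar> \<le> 2"
    proof (cases "n = 2")
      case True
      \<comment> \<open>For n = 2 the zero measure suffices, as the sum is at most 2; this case
        fixes C = 2, while odd n gives an error of 1.\<close>
      define N where "N = (null_measure borel :: torus measure)"
      have "finite_measure N" unfolding N_def by (rule finite_measureI) simp
      moreover have "fourier_coeff N l = 0" for l
        by (simp add: fourier_coeff_def N_def)
      then have "(\<lambda>l::nat. if odd l then (-1) ^ ((l - 1) div 2) / real l *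
          Re (fourier_coeff N (int l)) else 0) sums 0" by (simp cong: if_cong)
      moreover have "sets N = sets borel" by (simp add: N_def)
      ultimately show ?thesis using sign_cos_sum_le[of n a b] True
        by (intro exI[of _ N] exI[of _ 0]) simp
    next
      case False
      interpret odd_modulus n using False n by (rule odd_modulus_prime)
      define W where "W = (\<Sum>k\<in>{- r..r}. f (c * k))"
      have "4 * real n / pi * (pi / (2 * n) * W) = 2 * W" using n_pos by simp
      moreover have "\<bar>corr c 0 - 2 * W\<bar> = 1"
        unfolding W_def using q prime_residue_coprime[OF n, of c] by (intro corr_window_sum) (simp add: c_def)
      then have "\<bar>\<bar>corr c 0\<bar> - \<bar>2 * W\<bar>\<bar> \<le> 2" by linarith
      ultimately have "\<bar>sign_cos_sum n a b - \<bar>4 * real n / pi * (pi / (2 * n) * W)\<bar>\<bar> \<le> 2"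
        using sign_cos_sum_eq_corr[of a c b] q prime_residue_coprime[OF n, of a] by (simp add: c_def)
      moreover have "sets (progression_measure c) = sets borel" by (simp add: progression_measure_def)
      ultimately show ?thesis
        using finite_progression_measure[of c] fourier_progression_sums[of c] unfolding W_def by blast
    qed
  qed
qed

end
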